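(* Let $(X_t)_{t\geqslant 0}$ be a time-homogeneous, right-continuous, progressively measurable Markov process on a Polish space $(E,\mathscr{E})$ with extended generator $(L,D_w(L))$. Assume that $(X_t)_{t\geqslant 0}$ is non-explosive and ergodic, with invariant probability measure $\pi$. Let $\{E_n\}_{n=1}^{\infty}\subset\mathscr{E}$ be a sequence of bounded open sets with $E_n\uparrow E$ and $\bigcup_n E_n=E$, and let $H\subset E_1$ be a closed set with $\pi(H)>0$. Suppose that for each $n\geqslant 1$ there exists a non-negative function $u_n\in D_w(L)$ such that: (a) $Lu_n(x)\geqslant -1$ for all $x\in E_n\setminus H$; (b) $u_n(x)=0$ for $x\in E_n^c\cup H$, and $u_n$ is bounded on $E_n\setminus H$; and such that (c) $\sup_{x\notin H}\limsup_{n\to\infty}u_n(x)=\infty$. Then $(X_t)_{t\geqslant 0}$ is not strongly ergodic.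
   Context: The process $(X_t)_{t\geqslant0}$ has transition function $P_t(x,\cdot)$ and lives on a probability space with natural filtration $(\mathscr{F}_t)_{t\geqslant0}$; $\mathbb{P}_x,\mathbb{E}_x$ denote law and expectation for the process started at $x$. For $A\in\mathscr{E}$ the hitting time $\tau_A:=\inf\{t\geqslant0: X_t\in A\}$ is a stopping time. Invariant measure: a $\sigma$-finite measure $\pi$ with $\pi(A)=\int_E P_t(x,A)\,\pi(\mathrm{d}x)$ for all $t>0$, $A\in\mathscr{E}$. Ergodic: there is a unique invariant probability measure $\pi$ such that $\lim_{t\to\infty}\|P_t(x,\cdot)-\pi\|_{\mathrm{Var}}=0$ for all $x\in E$, where $\|\cdot\|_{\mathrm{Var}}$ is the total variation distance. Strongly ergodic (uniformly ergodic): there exist $\varepsilon>0$, $C>0$ and an invariant probability measure $\pi$ such that $\sup_{x\in E}\|P_t(x,\cdot)-\pi\|_{\mathrm{Var}}\leqslant C e^{-\varepsilon t}$ for all $t\geqslant 0$. Extended generator: $D_w(L)$ is the set of measurable functions $f:E\to\mathbb{R}$ for which there is a measurable function $Lf$ such that $f(X_t)-f(X_0)-\int_0^t Lf(X_s)\,\mathrm{d}s$ is a local martingale (under every $\mathbb{P}_x$). *)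

theory Defs
  imports "HOL-Probability.Probability"
begin

text \<open>The state space is a Polish type with its Borel sets. Transition functions may be
  sub-Markovian; the missing mass of \<open>P t x\<close> is the probability of having exploded by time \<open>t\<close>.
  Times are reals, and only times \<open>t \<ge> 0\<close> are ever constrained.\<close>

locale transition_function =
  fixes P :: "real \<Rightarrow> 'a::polish_space \<Rightarrow> 'a measure"
  assumes kernel: "t \<ge> 0 \<Longrightarrow> P t \<in> borel \<rightarrow>\<^sub>M subprob_algebra borel"
    and initial: "P 0 x = return borel x"
    and chapman_kolmogorov: "\<lbrakk>s \<ge> 0; t \<ge> 0\<rbrakk> \<Longrightarrow> P (s + t) x = P s x \<bind> P t"

definition tv_dist :: "'a::topological_space measure \<Rightarrow> 'a measure \<Rightarrow> real" where
  "tv_dist \<mu> \<nu> = (\<Squnion>A\<in>sets borel. \<bar>measure \<mu> A - measure \<nu> A\<bar>)"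

definition invariant_measure ::
  "(real \<Rightarrow> 'a::polish_space \<Rightarrow> 'a measure) \<Rightarrow> 'a measure \<Rightarrow> bool" where
  "invariant_measure P \<pi> \<longleftrightarrow> sigma_finite_measure \<pi> \<and> sets \<pi> = sets borel \<and>
     (\<forall>t>0. \<forall>A\<in>sets borel. emeasure \<pi> A = (\<integral>\<^sup>+ x. emeasure (P t x) A \<partial>\<pi>))"

definition invariant_prob ::
  "(real \<Rightarrow> 'a::polish_space \<Rightarrow> 'a measure) \<Rightarrow> 'a measure \<Rightarrow> bool" where
  "invariant_prob P \<pi> \<longleftrightarrow> invariant_measure P \<pi> \<and> prob_space \<pi>"

definition ergodic ::
  "(real \<Rightarrow> 'a::polish_space \<Rightarrow> 'a measure) \<Rightarrow> 'a measure \<Rightarrow> bool" where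
  "ergodic P \<pi> \<longleftrightarrow> invariant_prob P \<pi> \<and> (\<forall>\<nu>. invariant_prob P \<nu> \<longrightarrow> \<nu> = \<pi>) \<and>
     (\<forall>x. ((\<lambda>t. tv_dist (P t x) \<pi>) \<longlongrightarrow> 0) at_top)"

definition strongly_ergodic ::
  "(real \<Rightarrow> 'a::polish_space \<Rightarrow> 'a measure) \<Rightarrow> bool" where
  "strongly_ergodic P \<longleftrightarrow> (\<exists>\<epsilon>>0. \<exists>C>0. \<exists>\<pi>. invariant_prob P \<pi> \<and>
     (\<forall>t\<ge>0. (\<Squnion>x. tv_dist (P t x) \<pi>) \<le> C * exp (- \<epsilon> * t)))"

text \<open>Filtrations are indexed by extended times \<open>[0, \<infinity>]\<close>, so that the notion of
  \<open>stopping_time\<close> from the library admits the value \<open>\<infinity>\<close>.\<close>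

definition martingale ::
  "'w measure \<Rightarrow> (ennreal \<Rightarrow> 'w measure) \<Rightarrow> (real \<Rightarrow> 'w \<Rightarrow> real) \<Rightarrow> bool" where
  "martingale M F Y \<longleftrightarrow>
     (\<forall>t\<ge>0. Y t \<in> borel_measurable (F (ennreal t)) \<and> integrable M (Y t)) \<and>
     (\<forall>s t. 0 \<le> s \<and> s \<le> t \<longrightarrow>
        (AE \<omega> in M. real_cond_exp M (F (ennreal s)) (Y t) \<omega> = Y s \<omega>))"

definition stopped :: "(real \<Rightarrow> 'w \<Rightarrow> 'b) \<Rightarrow> ('w \<Rightarrow> ennreal) \<Rightarrow> real \<Rightarrow> 'w \<Rightarrow> 'b" where
  "stopped Y T t \<omega> = Y (enn2real (min (ennreal t) (T \<omega>))) \<omega>"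

text \<open>No path regularity is required of a (local) martingale.\<close>

definition local_martingale ::
  "'w measure \<Rightarrow> (ennreal \<Rightarrow> 'w measure) \<Rightarrow> (real \<Rightarrow> 'w \<Rightarrow> real) \<Rightarrow> bool" where
  "local_martingale M F Y \<longleftrightarrow>
     (\<forall>t\<ge>0. Y t \<in> borel_measurable (F (ennreal t))) \<and>
     (\<exists>T :: nat \<Rightarrow> 'w \<Rightarrow> ennreal.
        (\<forall>n. stopping_time F (T n)) \<and>
        (AE \<omega> in M. incseq (\<lambda>n. T n \<omega>) \<and> (\<lambda>n. T n \<omega>) \<longlonglongrightarrow> \<infinity>) \<and>
        (\<forall>n. martingale M F (stopped Y (T n))))"

text \<open>A process takes values in \<open>E \<union> {\<Delta>}\<close>, modelled as \<open>'a option\<close> with \<open>None\<close> as the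
  cemetery \<open>\<Delta>\<close>, in which the process stays after an explosion. Functions on \<open>E\<close> are extended
  by \<open>0\<close> at \<open>\<Delta>\<close>.\<close>

definition cemetery_borel :: "'a::topological_space option measure" where
  "cemetery_borel = sigma UNIV {B. Some -` B \<in> sets borel}"

definition ext :: "('a \<Rightarrow> real) \<Rightarrow> 'a option \<Rightarrow> real" where
  "ext f z = (case z of None \<Rightarrow> 0 | Some x \<Rightarrow> f x)"

text \<open>Only the measurable space underlying \<open>\<Omega>\<close> matters.\<close>

definition natural_filtration ::
  "'w measure \<Rightarrow> (real \<Rightarrow> 'w \<Rightarrow> 'a::topological_space option) \<Rightarrow> ennreal \<Rightarrow> 'w measure" where
  "natural_filtration \<Omega> X t = sigma (space \<Omega>)
     {X s -` B \<inter> space \<Omega> | s B. 0 \<le> s \<and> ennreal s \<le> t \<and> B \<in> sets cemetery_borel}"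

text \<open>\<open>\<P> x\<close> is the law on \<open>\<Omega>\<close> of the process \<open>X\<close> started at \<open>x\<close>.\<close>

locale markov_process = transition_function P
  for P :: "real \<Rightarrow> 'a::polish_space \<Rightarrow> 'a measure" +
  fixes \<Omega> :: "'w measure" and \<P> :: "'a \<Rightarrow> 'w measure" and X :: "real \<Rightarrow> 'w \<Rightarrow> 'a option"
  assumes prob: "prob_space (\<P> x)"
    and sets_law: "sets (\<P> x) = sets \<Omega>"
    and random_variable: "t \<ge> 0 \<Longrightarrow> X t \<in> \<Omega> \<rightarrow>\<^sub>M cemetery_borel"
    and absorbing: "\<lbrakk>\<omega> \<in> space \<Omega>; 0 \<le> s; s \<le> t; X s \<omega> = None\<rbrakk> \<Longrightarrow> X t \<omega> = None"
    and start: "AE \<omega> in \<P> x. X 0 \<omega> = Some x"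
    and markov_property: "\<lbrakk>s \<ge> 0; t \<ge> 0; A \<in> sets borel\<rbrakk> \<Longrightarrow>
      AE \<omega> in \<P> x. real_cond_exp (\<P> x) (natural_filtration \<Omega> X (ennreal s))
          (\<lambda>\<omega>'. indicator (Some ` A) (X (s + t) \<omega>')) \<omega>
        = ext (\<lambda>y. measure (P t y) A) (X s \<omega>)"

definition nonexplosive :: "('a \<Rightarrow> 'w measure) \<Rightarrow> (real \<Rightarrow> 'w \<Rightarrow> 'a option) \<Rightarrow> bool" where
  "nonexplosive \<P> X \<longleftrightarrow> (\<forall>x. AE \<omega> in \<P> x. \<forall>t\<ge>0. X t \<omega> \<noteq> None)"

definition right_continuous ::
  "('a::topological_space \<Rightarrow> 'w measure) \<Rightarrow> (real \<Rightarrow> 'w \<Rightarrow> 'a option) \<Rightarrow> bool" where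
  "right_continuous \<P> X \<longleftrightarrow> (\<forall>x. AE \<omega> in \<P> x. \<forall>t\<ge>0. \<forall>U. open U \<and> X t \<omega> \<in> Some ` U \<longrightarrow>
     (\<forall>\<^sub>F s in at_right t. X s \<omega> \<in> Some ` U))"

definition progressively_measurable ::
  "'w measure \<Rightarrow> (real \<Rightarrow> 'w \<Rightarrow> 'a::topological_space option) \<Rightarrow> bool" where
  "progressively_measurable \<Omega> X \<longleftrightarrow> (\<forall>t\<ge>0. (\<lambda>(s, \<omega>). X s \<omega>) \<in>
     restrict_space borel {0..t} \<Otimes>\<^sub>M natural_filtration \<Omega> X (ennreal t) \<rightarrow>\<^sub>M cemetery_borel)"

text \<open>The explicit integrability clause is needed because the Bochner integral of a
  non-integrable function is \<open>0\<close> by convention.\<close>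

definition generator_pair ::
  "'w measure \<Rightarrow> ('a::topological_space \<Rightarrow> 'w measure) \<Rightarrow> (real \<Rightarrow> 'w \<Rightarrow> 'a option) \<Rightarrow>
    ('a \<Rightarrow> real) \<Rightarrow> ('a \<Rightarrow> real) \<Rightarrow> bool" where
  "generator_pair \<Omega> \<P> X f g \<longleftrightarrow> f \<in> borel_measurable borel \<and> g \<in> borel_measurable borel \<and>
     (\<forall>x. (AE \<omega> in \<P> x. \<forall>t\<ge>0. set_integrable lborel {0..t} (\<lambda>s. ext g (X s \<omega>))) \<and>
          local_martingale (\<P> x) (natural_filtration \<Omega> X)
            (\<lambda>t \<omega>. ext f (X t \<omega>) - ext f (X 0 \<omega>) - (LINT s:{0..t}|lborel. ext g (X s \<omega>))))"

definition generator_domain ::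
  "'w measure \<Rightarrow> ('a::topological_space \<Rightarrow> 'w measure) \<Rightarrow> (real \<Rightarrow> 'w \<Rightarrow> 'a option) \<Rightarrow>
    ('a \<Rightarrow> real) set" where
  "generator_domain \<Omega> \<P> X = {f. \<exists>g. generator_pair \<Omega> \<P> X f g}"

text \<open>The function \<open>Lf\<close> is in general not determined by \<open>f\<close>; an extended generator is any choice
  of versions.\<close>

definition extended_generator ::
  "'w measure \<Rightarrow> ('a::topological_space \<Rightarrow> 'w measure) \<Rightarrow> (real \<Rightarrow> 'w \<Rightarrow> 'a option) \<Rightarrow>
    (('a \<Rightarrow> real) \<Rightarrow> 'a \<Rightarrow> real) \<Rightarrow> bool" where
  "extended_generator \<Omega> \<P> X L \<longleftrightarrow>
     (\<forall>f\<in>generator_domain \<Omega> \<P> X. generator_pair \<Omega> \<P> X f (L f))"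

end

theory Submission
  imports Defs "HOL-Real_Asymp.Real_Asymp"
begin

text \<open>If the process is strongly ergodic, then \<open>P \<tau> y H \<ge> \<delta> > 0\<close> for some \<open>\<tau>\<close> and all \<open>y\<close>, so
  \<open>H\<close> is hit along the grid \<open>\<tau>, 2\<tau>, \<dots>\<close> within expected time \<open>\<tau> / \<delta>\<close>. Off
  \<open>D = - E n \<union> H\<close> we have \<open>L u \<ge> -1\<close>, and \<open>u = 0\<close> on \<open>D\<close>, so optional stopping should give
  \<open>u x \<le> \<tau> / \<delta>\<close> for all \<open>n\<close> and \<open>x\<close>, contradicting the unboundedness of the \<open>u\<close>.

  Since the local martingales have no path regularity, stopping at the true hitting time of \<open>D\<close> is
  not available. Instead one stops at the first hit of \<open>D\<close> along finite grids increasing to a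
  countable set of times chosen so that, almost surely, the process spends no time in \<open>D\<close> before
  the first hit along that countable set. Such a set exists by exhaustion and Fubini. In the limit
  the uncontrolled values of \<open>L u\<close> on \<open>D\<close> do not contribute.\<close>

section \<open>Detecting visits along countably many times\<close>

text \<open>Exhaustion: countable subfamilies whose unions have measure close to the supremum
  \<open>\<alpha>\<close> merge into one countable \<open>C\<close> that attains it. A set
  \<open>S i\<close> leaving the union by positive measure would then exceed the supremum. As
  \<open>I\<close> may be uncountable, the null set has to depend on \<open>i\<close>.\<close>

lemma (in finite_measure) countable_essential_cover:
  fixes S :: "'i \<Rightarrow> 'a set"
  assumes S: "\<And>i. i \<in> I \<Longrightarrow> S i \<in> sets M"
  obtains C where "C \<subseteq> I" "countable C"
    "\<And>i. i \<in> I \<Longrightarrow> AE x in M. x \<in> S i \<longrightarrow> x \<in> (\<Union>c\<in>C. S c)"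
proof -
  define m where "m C = measure M (\<Union>c\<in>C. S c)" for C
  define \<C> where "\<C> = {C. C \<subseteq> I \<and> countable C}"
  define \<alpha> where "\<alpha> = (SUP C\<in>\<C>. m C)"
  have meas: "(\<Union>c\<in>C. S c) \<in> sets M" if "C \<in> \<C>" for C
    using that S by (intro sets.countable_UN') (auto simp: \<C>_def)
  have bdd: "bdd_above (m ` \<C>)"
    unfolding m_def by (intro bdd_aboveI[of _ "measure M (space M)"]) (auto intro: bounded_measure)
  have ne: "\<C> \<noteq> {}" by (auto simp: \<C>_def)
  have "\<exists>C\<in>\<C>. \<alpha> - 1 / (real n + 1) < m C" for n
    using less_cSUP_iff[OF ne bdd, of "\<alpha> - 1 / (real n + 1)"] by (simp add: \<alpha>_def)
  then obtain D where D: "\<And>n. D n \<in> \<C>" "\<And>n. \<alpha> - 1 / (real n + 1) < m (D n)"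
    by metis
  define C where "C = (\<Union>n. D n)"
  have C: "C \<in> \<C>" using D(1) by (auto simp: C_def \<C>_def)
  have ge: "\<alpha> \<le> m C"
  proof (rule field_le_epsilon)
    fix e :: real assume "0 < e"
    then obtain n where "1 / (real n + 1) < e"
      using nat_approx_posE[of e] by (metis of_nat_Suc add.commute)
    moreover have "m (D n) \<le> m C"
      unfolding m_def using meas[OF C] by (intro finite_measure_mono) (auto simp: C_def)
    ultimately show "\<alpha> \<le> m C + e" using D(2)[of n] by simp
  qed
  have "AE x in M. x \<in> S i \<longrightarrow> x \<in> (\<Union>c\<in>C. S c)" if i: "i \<in> I" for i
  proof -
    let ?U = "\<Union>c\<in>C. S c"
    have iC: "insert i C \<in> \<C>" using C i by (auto simp: \<C>_def)
    have "m (insert i C) \<le> \<alpha>" unfolding \<alpha>_def by (rule cSUP_upper[OF iC bdd])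
    moreover have "m (insert i C) = m C + measure M (S i - ?U)"
    proof -
      have "(\<Union>c\<in>insert i C. S c) = ?U \<union> (S i - ?U)" by auto
      then show ?thesis
        unfolding m_def using finite_measure_Union[of ?U "S i - ?U"] meas[OF C] S[OF i]
        by auto
    qed
    ultimately have "measure M (S i - ?U) = 0"
      using ge by (simp add: order_antisym)
    then have "S i - ?U \<in> null_sets M"
      using meas[OF C] S[OF i] by (auto simp: null_sets_def emeasure_eq_measure)
    then have "AE x in M. x \<notin> S i - ?U" by (rule AE_not_in)
    then show ?thesis by eventually_elim auto
  qed
  with C show thesis by (intro that[of C]) (auto simp: \<C>_def)
qed

text \<open>Exhaustion is applied to the sections of \<open>S\<close> over points of
  \<open>N\<close>: each lies, up to a null set, in a countable union \<open>U\<close> of such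
  sections. Fubini exchanges the two almost-everywhere quantifiers, so for almost every
  \<open>y\<close> outside \<open>U\<close> the section of \<open>S\<close> at \<open>y\<close> is
  \<open>N\<close>-null.\<close>

lemma countable_section_cover:
  assumes "finite_measure M" "sigma_finite_measure N" and S: "S \<in> sets (N \<Otimes>\<^sub>M M)"
  obtains C where "C \<subseteq> space N" "countable C"
    "AE y in M. (\<exists>c\<in>C. (c, y) \<in> S) \<or> (AE x in N. (x, y) \<notin> S)"
proof -
  interpret M: finite_measure M by fact
  interpret N: sigma_finite_measure N by fact
  interpret pair_sigma_finite N M ..
  obtain C where C: "C \<subseteq> space N" "countable C"
    "\<And>x. x \<in> space N \<Longrightarrow> AE y in M. y \<in> Pair x -` S \<longrightarrow> y \<in> (\<Union>c\<in>C. Pair c -` S)"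
    using M.countable_essential_cover[of "space N" "\<lambda>x. Pair x -` S"] sets_Pair1[OF S] by blast
  define U where "U = (\<Union>c\<in>C. Pair c -` S)"
  have U[measurable]: "U \<in> sets M"
    unfolding U_def using C sets_Pair1[OF S] by (intro sets.countable_UN') auto
  have [measurable]: "S \<in> sets (N \<Otimes>\<^sub>M M)" by fact
  have "AE x in N. AE y in M. (x, y) \<in> S \<longrightarrow> y \<in> U"
    by (rule AE_I2) (use C(3) in \<open>simp add: U_def\<close>)
  then have "AE y in M. AE x in N. (x, y) \<in> S \<longrightarrow> y \<in> U"
    by (subst AE_commute[symmetric]) (simp_all add: split_beta')
  then have "AE y in M. (\<exists>c\<in>C. (c, y) \<in> S) \<or> (AE x in N. (x, y) \<notin> S)"
  proof eventually_elim
    case (elim y)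
    show ?case
    proof (cases "y \<in> U")
      case False
      then show ?thesis using elim by simp
    qed (auto simp: U_def)
  qed
  with C show thesis by (intro that)
qed

text \<open>Passes from whole intervals to single times. If \<open>s < s'\<close> both lie in the
  bad set \<open>A\<close>, a rational \<open>r\<close> between them has no hit in \<open>C\<close>
  up to \<open>r\<close>, so the visits up to \<open>r\<close> form a null set, and \<open>s\<close>
  is one of them. Countably many \<open>r\<close> suffice, hence \<open>A\<close> is null up to a
  possible maximum.\<close>

lemma AE_hit_before:
  fixes D C :: "real set"
  assumes r: "\<And>r. r \<in> \<rat> \<Longrightarrow> 0 \<le> r \<Longrightarrow>
    (\<exists>q\<in>C. q \<in> {0..r} \<and> q \<in> D) \<or> (AE s in lborel. s \<in> {0..r} \<longrightarrow> s \<notin> D)"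
  shows "AE s in lborel. 0 \<le> s \<and> s \<in> D \<longrightarrow> (\<exists>q\<in>C. q \<in> {0..s} \<and> q \<in> D)"
proof -
  define A where "A = {s. 0 \<le> s \<and> s \<in> D \<and> \<not> (\<exists>q\<in>C. q \<in> {0..s} \<and> q \<in> D)}"
  define R where "R = {r \<in> \<rat>. AE s in lborel. s \<in> {0..r} \<longrightarrow> s \<notin> D}"
  have "countable R" unfolding R_def using countable_rat by (rule countable_subset[rotated]) auto
  then have "AE s in lborel. \<forall>r\<in>R. s \<in> {0..r} \<longrightarrow> s \<notin> D"
    by (subst AE_ball_countable) (auto simp: R_def)
  \<comment> \<open>If \<open>A\<close> has a maximum, it is \<open>Sup A\<close>; every other point
    of \<open>A\<close> lies strictly below another one.\<close>
  moreover have "AE s in lborel. s \<noteq> Sup A"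
    by (intro AE_lborel_singleton)
  ultimately show ?thesis
  proof eventually_elim
    case (elim s)
    have "s \<notin> A"
    proof
      assume s: "s \<in> A"
      have "\<exists>s'\<in>A. s < s'"
      proof (rule ccontr)
        assume "\<not> ?thesis"
        then have "Sup A = s" using s by (intro cSup_eq_maximum) auto
        with elim show False by simp
      qed
      then obtain s' where s': "s' \<in> A" "s < s'" by auto
      obtain r where r': "r \<in> \<rat>" "s < r" "r < s'" using Rats_dense_in_real[OF s'(2)] by auto
      have "0 \<le> r" using s r' by (auto simp: A_def)
      have "\<not> (\<exists>q\<in>C. q \<in> {0..r} \<and> q \<in> D)"
        using s' r' by (fastforce simp: A_def)
      then have "r \<in> R" using r[OF r'(1) \<open>0 \<le> r\<close>] r' by (auto simp: R_def)
      then show False using elim s r' by (auto simp: A_def)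
    qed
    then show ?case by (auto simp: A_def)
  qed
qed

text \<open>A deterministic grid that is merely dense in time need not detect a visit of positive duration, because
  the visited set of times may be a fat Cantor set; the grid has to be adapted to the law.\<close>

lemma countable_hitting_times:
  fixes d :: "real \<Rightarrow> 'w \<Rightarrow> bool"
  assumes "finite_measure M"
    and meas: "\<And>t. 0 \<le> t \<Longrightarrow>
      {(s, \<omega>). s \<in> {0..t} \<and> \<omega> \<in> space M \<and> d s \<omega>} \<in> sets (restrict_space borel {0..t} \<Otimes>\<^sub>M M)"
  obtains C where "countable C" "C \<subseteq> {0..}"
    "AE \<omega> in M. AE s in lborel. 0 \<le> s \<and> d s \<omega> \<longrightarrow> (\<exists>q\<in>C. q \<le> s \<and> d q \<omega>)"
proof -
  interpret finite_measure M by fact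
  define S where "S t = {(s, \<omega>). s \<in> {0..t} \<and> \<omega> \<in> space M \<and> d s \<omega>}" for t :: real
  define covers where "covers t C \<longleftrightarrow> C \<subseteq> {0..t} \<and> countable C \<and>
    (AE \<omega> in M. (\<exists>c\<in>C. (c, \<omega>) \<in> S t) \<or>
      (AE s in lborel. s \<in> {0..t} \<longrightarrow> (s, \<omega>) \<notin> S t))" for t C
  have "\<exists>C. covers t C" if t: "0 \<le> t" for t
  proof -
    have sf: "sigma_finite_measure (restrict_space lborel {0..t})"
      by (rule sigma_finite_measure_restrict_space[OF sigma_finite_lborel]) simp
    have St: "S t \<in> sets (restrict_space lborel {0..t} \<Otimes>\<^sub>M M)"
    proof -
      have "sets (restrict_space lborel {0..t} \<Otimes>\<^sub>M M) = sets (restrict_space borel {0..t} \<Otimes>\<^sub>M M)"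
        by (intro sets_pair_measure_cong sets_restrict_space_cong) auto
      then show ?thesis using meas[OF t] by (simp add: S_def)
    qed
    obtain C where C: "C \<subseteq> space (restrict_space lborel {0..t})" "countable C"
      "AE \<omega> in M. (\<exists>c\<in>C. (c, \<omega>) \<in> S t) \<or> (AE s in restrict_space lborel {0..t}. (s, \<omega>) \<notin> S t)"
      by (rule countable_section_cover[OF finite_measure_axioms sf St])
    from C(3) have "AE \<omega> in M. (\<exists>c\<in>C. (c, \<omega>) \<in> S t) \<or> (AE s in lborel. s \<in> {0..t} \<longrightarrow> (s, \<omega>) \<notin> S t)"
      by (simp add: AE_restrict_space_iff)
    with C(1,2) show ?thesis by (intro exI[of _ C]) (auto simp: covers_def space_restrict_space)
  qed
  then obtain C where "\<And>t. 0 \<le> t \<Longrightarrow> covers t (C t)" by metis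
  then have C: "\<And>t. 0 \<le> t \<Longrightarrow> C t \<subseteq> {0..t}" "\<And>t. 0 \<le> t \<Longrightarrow> countable (C t)"
    "\<And>t. 0 \<le> t \<Longrightarrow> AE \<omega> in M. (\<exists>c\<in>C t. (c, \<omega>) \<in> S t) \<or>
      (AE s in lborel. s \<in> {0..t} \<longrightarrow> (s, \<omega>) \<notin> S t)"
    unfolding covers_def by simp_all
  \<comment> \<open>Each \<open>C t\<close> depends on the horizon \<open>t\<close>. Rational
    horizons keep the union countable and are all that \<open>AE_hit_before\<close> asks
    for.\<close>
  define C' where "C' = (\<Union>t\<in>\<rat> \<inter> {0..}. C t)"
  have "countable (\<rat> \<inter> {0::real..})"
    by (rule countable_subset[OF _ countable_rat]) auto
  then have C': "countable C'"
    using C(2) by (auto simp: C'_def)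
  have C'_nonneg: "C' \<subseteq> {0..}"
    unfolding C'_def
  proof (rule UN_least)
    fix t :: real assume "t \<in> \<rat> \<inter> {0..}"
    then show "C t \<subseteq> {0..}" using C(1)[of t] by auto
  qed
  have "AE \<omega> in M. \<forall>t\<in>\<rat> \<inter> {0..}. (\<exists>c\<in>C t. (c, \<omega>) \<in> S t) \<or>
      (AE s in lborel. s \<in> {0..t} \<longrightarrow> (s, \<omega>) \<notin> S t)"
    using C(3) \<open>countable (\<rat> \<inter> {0::real..})\<close> by (subst AE_ball_countable) auto
  then have "AE \<omega> in M. AE s in lborel. 0 \<le> s \<and> d s \<omega> \<longrightarrow> (\<exists>q\<in>C'. q \<le> s \<and> d q \<omega>)"
    using AE_space
  proof eventually_elim
    case (elim \<omega>)
    have "AE s in lborel. 0 \<le> s \<and> s \<in> {s. d s \<omega>} \<longrightarrow>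
        (\<exists>q\<in>C'. q \<in> {0..s} \<and> q \<in> {s. d s \<omega>})"
    proof (rule AE_hit_before)
      fix r :: real assume r: "r \<in> \<rat>" "0 \<le> r"
      with elim have "(\<exists>c\<in>C r. (c, \<omega>) \<in> S r) \<or>
        (AE s in lborel. s \<in> {0..r} \<longrightarrow> (s, \<omega>) \<notin> S r)" by auto
      then show "(\<exists>q\<in>C'. q \<in> {0..r} \<and> q \<in> {s. d s \<omega>}) \<or>
        (AE s in lborel. s \<in> {0..r} \<longrightarrow> s \<notin> {s. d s \<omega>})"
      proof
        assume "\<exists>c\<in>C r. (c, \<omega>) \<in> S r"
        then show ?thesis using r by (auto simp: S_def C'_def)
      next
        assume "AE s in lborel. s \<in> {0..r} \<longrightarrow> (s, \<omega>) \<notin> S r"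
        then have "AE s in lborel. s \<in> {0..r} \<longrightarrow> s \<notin> {s. d s \<omega>}"
          using elim by (simp add: S_def)
        then show ?thesis ..
      qed
    qed
    then show ?case by eventually_elim auto
  qed
  with C' C'_nonneg show thesis by (rule that)
qed

section \<open>Optional sampling along finite grids\<close>

locale filtered_prob_space = prob_space M + filtration "space M" F
  for M :: "'w measure" and F :: "ennreal \<Rightarrow> 'w measure" +
  assumes sets_F_subset: "sets (F t) \<subseteq> sets M"
begin

lemma sets_F_imp_sets_M: "A \<in> sets (F t) \<Longrightarrow> A \<in> sets M"
  using sets_F_subset by blast

lemma borel_measurable_F_imp_M: "f \<in> borel_measurable (F t) \<Longrightarrow> f \<in> borel_measurable M"
  using sets_F_subset[of t] unfolding measurable_def by (auto simp: space_F)

lemma sigma_finite_subalgebra_F: "sigma_finite_subalgebra M (F t)"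
proof -
  interpret finite_measure_subalgebra M "F t"
    using sets_F_subset by unfold_locales (simp add: subalgebra_def space_F)
  show ?thesis ..
qed

lemma martingale_set_integral:
  assumes Z: "martingale M F Z" and st: "0 \<le> s" "s \<le> t" and A: "A \<in> sets (F (ennreal s))"
  shows "(LINT \<omega>:A|M. Z t \<omega>) = (LINT \<omega>:A|M. Z s \<omega>)"
proof -
  interpret sigma_finite_subalgebra M "F (ennreal s)" by (rule sigma_finite_subalgebra_F)
  have int: "integrable M (Z t)" "Z s \<in> borel_measurable M"
    using Z st by (auto simp: martingale_def intro: borel_measurable_F_imp_M)
  have "(LINT \<omega>:A|M. Z t \<omega>) = (LINT \<omega>:A|M. real_cond_exp M (F (ennreal s)) (Z t) \<omega>)"
    by (rule real_cond_exp_intA[OF int(1) A])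
  also have "\<dots> = (LINT \<omega>:A|M. Z s \<omega>)"
    unfolding set_lebesgue_integral_def
  proof (rule integral_cong_AE)
    have "AE \<omega> in M. real_cond_exp M (F (ennreal s)) (Z t) \<omega> = Z s \<omega>"
      using Z st unfolding martingale_def by blast
    then show "AE \<omega> in M. indicator A \<omega> *\<^sub>R real_cond_exp M (F (ennreal s)) (Z t) \<omega> =
        indicator A \<omega> *\<^sub>R Z s \<omega>"
      by eventually_elim simp
  qed (use int sets_F_imp_sets_M[OF A] in auto)
  finally show ?thesis .
qed

text \<open>Since \<open>\<rho>\<close> has finitely many values, no path regularity enters:
  \<open>V - Z t\<close> is the sum over \<open>q\<close> of \<open>Z q - Z t\<close> restricted to
  \<open>B q\<close>, an event known at time \<open>q\<close>, so each summand has mean zero. The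
  events \<open>A q\<close> permit replacing the sampled value by the terminal one where the former
  cannot be controlled.\<close>

lemma discrete_optional_sampling:
  assumes Z: "martingale M F Z" and Q: "finite Q" "Q \<subseteq> {0..t}"
    and \<rho>: "\<And>\<omega>. \<omega> \<in> space M \<Longrightarrow> \<rho> \<omega> \<in> Q"
      "\<And>q. q \<in> Q \<Longrightarrow> {\<omega> \<in> space M. \<rho> \<omega> = q} \<in> sets (F (ennreal q))"
    and A: "\<And>q. q \<in> Q \<Longrightarrow> A q \<in> sets (F (ennreal q))"
  defines "V \<equiv> (\<lambda>\<omega>. if \<omega> \<in> A (\<rho> \<omega>) then Z t \<omega> else Z (\<rho> \<omega>) \<omega>)"
  shows "integrable M V" "integral\<^sup>L M V = integral\<^sup>L M (Z t)"
proof -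
  define B where "B q = {\<omega> \<in> space M. \<rho> \<omega> = q} - A q" for q
  have B: "B q \<in> sets (F (ennreal q))" if "q \<in> Q" for q
    unfolding B_def using \<rho>(2)[OF that] A[OF that] by auto
  \<comment> \<open>A probability space has a point, so \<open>\<rho>\<close> takes some value in
    \<open>Q\<close>, and this makes \<open>{0..t}\<close> nonempty.\<close>
  obtain \<omega>0 where "\<omega>0 \<in> space M" using not_empty by auto
  then have t: "0 \<le> t" using \<rho>(1) Q by fastforce
  have int: "integrable M (Z s)" if "0 \<le> s" for s using Z that by (auto simp: martingale_def)
  have intB: "integrable M (\<lambda>\<omega>. indicator (B q) \<omega> * Z s \<omega>)" if "q \<in> Q" "0 \<le> s" for q s
    using integrable_mult_indicator[OF sets_F_imp_sets_M[OF B[OF that(1)]] int[OF that(2)]] by simp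
  have V: "V \<omega> = Z t \<omega> + (\<Sum>q\<in>Q. indicator (B q) \<omega> * Z q \<omega> - indicator (B q) \<omega> * Z t \<omega>)"
    if w: "\<omega> \<in> space M" for \<omega>
  proof -
    have "(\<Sum>q\<in>Q. indicator (B q) \<omega> * Z q \<omega> - indicator (B q) \<omega> * Z t \<omega>) =
      (\<Sum>q\<in>Q. if q = \<rho> \<omega> then (if \<omega> \<in> A (\<rho> \<omega>) then 0 else Z (\<rho> \<omega>) \<omega> - Z t \<omega>) else 0)"
      using w by (intro sum.cong) (auto simp: B_def indicator_def)
    also have "\<dots> = (if \<omega> \<in> A (\<rho> \<omega>) then 0 else Z (\<rho> \<omega>) \<omega> - Z t \<omega>)"
      using \<rho>(1)[OF w] Q(1) by (simp add: sum.delta)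
    finally show ?thesis by (simp add: V_def)
  qed
  have Q0: "0 \<le> q" "q \<le> t" if "q \<in> Q" for q using that Q by auto
  have "integrable M (\<lambda>\<omega>. Z t \<omega> +
      (\<Sum>q\<in>Q. indicator (B q) \<omega> * Z q \<omega> - indicator (B q) \<omega> * Z t \<omega>))"
    by (intro Bochner_Integration.integrable_add Bochner_Integration.integrable_sum
        Bochner_Integration.integrable_diff int intB t Q0)
  then show "integrable M V"
    by (subst Bochner_Integration.integrable_cong[OF refl V])
  have "integral\<^sup>L M V = (LINT \<omega>|M. Z t \<omega> +
      (\<Sum>q\<in>Q. indicator (B q) \<omega> * Z q \<omega> - indicator (B q) \<omega> * Z t \<omega>))"
    by (rule Bochner_Integration.integral_cong[OF refl V])
  also have "\<dots> = integral\<^sup>L M (Z t) + (\<Sum>q\<in>Q. (LINT \<omega>|M. indicator (B q) \<omega> * Z q \<omega>) -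
      (LINT \<omega>|M. indicator (B q) \<omega> * Z t \<omega>))"
    using int intB t Q0
    by (subst Bochner_Integration.integral_add, simp, (intro Bochner_Integration.integrable_sum
        Bochner_Integration.integrable_diff; simp)) (simp add: Bochner_Integration.integral_sum)
  also have "(\<Sum>q\<in>Q. (LINT \<omega>|M. indicator (B q) \<omega> * Z q \<omega>) -
      (LINT \<omega>|M. indicator (B q) \<omega> * Z t \<omega>)) = 0"
    using martingale_set_integral[OF Z Q0 B]
    by (intro sum.neutral) (auto simp: set_lebesgue_integral_def)
  finally show "integral\<^sup>L M V = integral\<^sup>L M (Z t)" by simp
qed

end

text \<open>The value is \<open>t\<close> if there is no hit in \<open>Q\<close>.\<close>

definition first_hit :: "(real \<Rightarrow> 'w \<Rightarrow> bool) \<Rightarrow> real set \<Rightarrow> real \<Rightarrow> 'w \<Rightarrow> real" where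
  "first_hit d Q t \<omega> = Min (insert t {q \<in> Q. d q \<omega>})"

context
  fixes Q :: "real set" and t :: real
  assumes Q: "finite Q" "Q \<subseteq> {0..t}" "t \<in> Q"
begin

lemma first_hit_in: "first_hit d Q t \<omega> \<in> Q"
proof -
  have "first_hit d Q t \<omega> \<in> insert t {q \<in> Q. d q \<omega>}"
    unfolding first_hit_def using Q by (intro Min_in) auto
  then show ?thesis using Q by auto
qed

lemma first_hit_le: "q \<in> Q \<Longrightarrow> d q \<omega> \<Longrightarrow> first_hit d Q t \<omega> \<le> q"
  unfolding first_hit_def using Q by (intro Min_le) auto

lemma first_hit_cases: "d (first_hit d Q t \<omega>) \<omega> \<or> first_hit d Q t \<omega> = t"
proof -
  have "first_hit d Q t \<omega> \<in> insert t {q \<in> Q. d q \<omega>}"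
    unfolding first_hit_def using Q by (intro Min_in) auto
  then show ?thesis by auto
qed

text \<open>The right-hand side inspects \<open>d\<close> only at grid times up to \<open>q\<close>,
  which is why the first hit is a stopping time. The disjunct \<open>q = t\<close> accounts for the
  default value.\<close>

lemma first_hit_eq_iff:
  assumes "q \<in> Q"
  shows "first_hit d Q t \<omega> = q \<longleftrightarrow> (q = t \<or> d q \<omega>) \<and> (\<forall>r\<in>Q. r < q \<longrightarrow> \<not> d r \<omega>)"
proof
  assume "first_hit d Q t \<omega> = q"
  then show "(q = t \<or> d q \<omega>) \<and> (\<forall>r\<in>Q. r < q \<longrightarrow> \<not> d r \<omega>)"
    using first_hit_cases[of d \<omega>] first_hit_le[of _ d \<omega>] by force
next
  assume "(q = t \<or> d q \<omega>) \<and> (\<forall>r\<in>Q. r < q \<longrightarrow> \<not> d r \<omega>)"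
  then show "first_hit d Q t \<omega> = q"
    unfolding first_hit_def using Q assms by (intro Min_eqI) force+
qed

end

lemma (in filtered_prob_space) sets_first_hit_eq:
  assumes Q: "finite Q" "Q \<subseteq> {0..t}" "t \<in> Q"
    and d: "\<And>s. 0 \<le> s \<Longrightarrow> {\<omega> \<in> space M. d s \<omega>} \<in> sets (F (ennreal s))" and q: "q \<in> Q"
  shows "{\<omega> \<in> space M. first_hit d Q t \<omega> = q} \<in> sets (F (ennreal q))"
proof -
  have d': "{\<omega> \<in> space M. d r \<omega>} \<in> sets (F (ennreal q))" if "r \<in> Q" "r \<le> q" for r
    using d[of r] sets_F_mono[OF ennreal_leI[OF that(2)]] that(1) Q(2) by force
  have [simp]: "space M \<in> sets (F s)" for s using sets.top[of "F s"] by (simp add: space_F)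
  have "{\<omega> \<in> space M. first_hit d Q t \<omega> = q} =
      (if q = t then space M else {\<omega> \<in> space M. d q \<omega>}) - (\<Union>r\<in>{r \<in> Q. r < q}. {\<omega> \<in> space M. d r \<omega>})"
    using first_hit_eq_iff[OF Q q, of d] by auto
  also have "\<dots> \<in> sets (F (ennreal q))"
    using d' q Q by (intro sets.Diff sets.finite_UN) auto
  finally show ?thesis .
qed

section \<open>Path integrals up to the grid hitting times\<close>

text \<open>Off \<open>D\<close> the integrand is at least -1, which contributes at most
  \<open>r\<close>. Almost every time in \<open>D\<close> is preceded by a hit in \<open>C\<close>,
  hence eventually lies beyond \<open>\<rho> m\<close>, so the contribution of \<open>D\<close>
  vanishes by dominated convergence. The bound is uniform in \<open>r\<close> because the stopped
  process may be evaluated before \<open>\<rho> m\<close>.\<close>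

lemma eventually_integral_lower_bound:
  fixes h :: "real \<Rightarrow> real" and \<rho> :: "nat \<Rightarrow> real"
  assumes h: "set_integrable lborel {0..t} h"
    and D: "D \<inter> {0..t} \<in> sets borel"
    and hD: "\<And>s. 0 \<le> s \<Longrightarrow> -1 \<le> h s \<or> s \<in> D"
    and C: "countable C" "C \<subseteq> {0..}"
      "AE s in lborel. 0 \<le> s \<and> s \<in> D \<longrightarrow> (\<exists>q\<in>C. q \<le> s \<and> q \<in> D)"
    and \<rho>: "\<And>m. \<rho> m \<le> t"
      "\<And>q. q \<in> C \<Longrightarrow> q \<le> t \<Longrightarrow> q \<in> D \<Longrightarrow> \<forall>\<^sub>F m in sequentially. \<rho> m \<le> q"
    and \<epsilon>: "0 < \<epsilon>"
  shows "\<forall>\<^sub>F m in sequentially. \<forall>r\<in>{0..\<rho> m}. - (LINT s:{0..r}|lborel. h s) \<le> r + \<epsilon>"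
proof -
  \<comment> \<open>The uncontrolled part: \<open>\<bar>h\<bar>\<close> on the visits to
    \<open>D\<close> up to \<open>\<rho> m\<close>. It serves as a majorant for all
    \<open>r \<le> \<rho> m\<close> at once.\<close>
  define f where "f m s = indicator {0..t} s * \<bar>h s\<bar> * indicator (D \<inter> {0..t} \<inter> {..\<rho> m}) s" for m s
  have hI: "integrable lborel (\<lambda>s. indicator {0..t} s * h s)"
    using h by (simp add: set_integrable_def)
  have [measurable]: "(\<lambda>s. indicator {0..t} s * h s) \<in> borel_measurable borel"
    using borel_measurable_integrable[OF hI] by simp
  have eq: "indicator {0..t} s * \<bar>h s\<bar> = \<bar>indicator {0..t} s * h s\<bar>" for s :: real
    by (auto simp: indicator_def)
  have f_meas: "f m \<in> borel_measurable lborel" for m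
    unfolding f_def[abs_def] eq using D by measurable
  have lim: "AE s in lborel. (\<lambda>m. f m s) \<longlonglongrightarrow> 0"
  proof -
    \<comment> \<open>Discarding the null set \<open>C\<close> makes the hit strictly earlier than
      \<open>s\<close>; with \<open>q = s\<close> the point \<open>s\<close> would still belong to
      \<open>{..\<rho> m}\<close>.\<close>
    have "AE s in lborel. \<forall>q\<in>C. s \<noteq> q"
      by (subst AE_ball_countable[OF C(1)]) (auto intro: AE_lborel_singleton)
    with C(3) show ?thesis
    proof eventually_elim
      case (elim s)
      show ?case
      proof (cases "s \<in> {0..t} \<and> s \<in> D")
        case True
        with elim obtain q where q: "q \<in> C" "q \<le> s" "q \<in> D" by auto
        with elim have "q < s" by force
        have "\<forall>\<^sub>F m in sequentially. \<rho> m \<le> q" using \<rho>(2) q True by auto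
        then have "\<forall>\<^sub>F m in sequentially. f m s = 0"
          by eventually_elim (use \<open>q < s\<close> in \<open>auto simp: f_def\<close>)
        then show ?thesis by (rule tendsto_eventually)
      next
        case False
        then have "f m s = 0" for m by (auto simp: f_def indicator_def)
        then show ?thesis by simp
      qed
    qed
  qed
  have dom: "AE s in lborel. norm (f m s) \<le> \<bar>indicator {0..t} s * h s\<bar>" for m
    by (rule AE_I2) (auto simp: f_def indicator_def)
  have f_int: "integrable lborel (f m)" for m
    by (rule Bochner_Integration.integrable_bound[OF integrable_abs[OF hI] f_meas])
      (use dom[of m] in \<open>auto simp: abs_mult\<close>)
  have "(\<lambda>m. integral\<^sup>L lborel (f m)) \<longlonglongrightarrow> integral\<^sup>L lborel (\<lambda>_::real. 0::real)"
    by (rule integral_dominated_convergence[OF _ f_meas integrable_abs[OF hI] lim dom]) simp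
  then have "\<forall>\<^sub>F m in sequentially. integral\<^sup>L lborel (f m) < \<epsilon>"
    using \<epsilon> by (intro order_tendstoD(2)[where y=0]) auto
  then show ?thesis
  proof eventually_elim
    case (elim m)
    show ?case
    proof
      fix r assume r: "r \<in> {0..\<rho> m}"
      have rt: "{0..r} \<subseteq> {0..t}" using r \<rho>(1)[of m] by auto
      have h_r: "set_integrable lborel {0..r} h"
        by (rule set_integrable_subset[OF h _ rt]) simp
      have ind_r: "integrable lborel (indicator {0..r} :: real \<Rightarrow> real)"
        by (rule integrable_real_indicator) (use r in auto)
      have "- (LINT s:{0..r}|lborel. h s) = (LINT s|lborel. - (indicator {0..r} s * h s))"
        by (simp add: set_lebesgue_integral_def)
      also have "\<dots> \<le> (LINT s|lborel. indicator {0..r} s + f m s)"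
      proof (rule integral_mono)
        show "integrable lborel (\<lambda>s. - (indicator {0..r} s * h s))"
          using h_r by (simp add: set_integrable_def)
        show "integrable lborel (\<lambda>s. indicator {0..r} s + f m s)"
          using ind_r f_int by simp
        fix s
        show "- (indicator {0..r} s * h s) \<le> indicator {0..r} s + f m s"
          using hD[of s] rt r by (auto simp: f_def indicator_def)
      qed
      also have "\<dots> = r + integral\<^sup>L lborel (f m)"
        using ind_r f_int r by (simp add: Bochner_Integration.integral_add)
      finally show "- (LINT s:{0..r}|lborel. h s) \<le> r + \<epsilon>" using elim by simp
    qed
  qed
qed

lemma measurable_le_stopping_time:
  assumes "filtration \<Omega> F" "stopping_time F T"
  shows "{\<omega> \<in> \<Omega>. (t::ennreal) \<le> T \<omega>} \<in> sets (F t)"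
proof -
  interpret filtration \<Omega> F by fact
  have "Measurable.pred (F t) (\<lambda>\<omega>. \<not> T \<omega> < t)"
    using stopping_time_less_const[OF assms(2)] by measurable
  then show ?thesis by (simp add: pred_def space_F not_less)
qed

section \<open>Expectation estimate on one finite grid\<close>

context filtered_prob_space
begin

text \<open>\<open>W q\<close> is the bound expected for the stopped process at time
  \<open>q\<close>: the value of \<open>u\<close> is at most \<open>K\<close>, and it is 0 at a hit,
  which can be used only if \<open>T\<close> has not stopped the process before \<open>q\<close>.
  Sampling at \<open>\<rho>\<close> off \<open>A\<close>, where \<open>W\<close> and then
  \<open>G\<close> bound the value, and at \<open>t\<close> on \<open>A\<close> gives a variable of
  mean 0, since the process starts at 0.\<close>

lemma grid_estimate:
  fixes Y :: "real \<Rightarrow> 'w \<Rightarrow> real" and T :: "'w \<Rightarrow> ennreal"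
  assumes Z: "martingale M F (stopped Y T)" and T: "stopping_time F T"
    and Y0: "AE \<omega> in M. Y 0 \<omega> = 0"
    and d: "\<And>s. 0 \<le> s \<Longrightarrow> {\<omega> \<in> space M. d s \<omega>} \<in> sets (F (ennreal s))"
    and Q: "finite Q" "Q \<subseteq> {0..t}" "t \<in> Q"
    and K: "0 \<le> K" "0 \<le> c" "0 \<le> \<epsilon>"
  defines "\<rho> \<equiv> first_hit d Q t"
    and "W \<equiv> (\<lambda>q \<omega>. (if d q \<omega> \<and> ennreal q \<le> T \<omega> then 0 else K) - c + q + \<epsilon>)"
  defines "A \<equiv> {\<omega> \<in> space M. W (\<rho> \<omega>) \<omega> < stopped Y T (\<rho> \<omega>) \<omega>}"
  assumes G: "integrable M G" "\<And>\<omega>. \<omega> \<in> space M \<Longrightarrow> W (\<rho> \<omega>) \<omega> \<le> G \<omega>"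
  shows "A \<in> sets M"
    and "0 \<le> (LINT \<omega>|M. indicator A \<omega> * (\<bar>stopped Y T t \<omega>\<bar> + c)) + integral\<^sup>L M G"
proof -
  let ?Z = "stopped Y T"
  have Q0: "0 \<le> q" "q \<le> t" if "q \<in> Q" for q using that Q by auto
  have t: "0 \<le> t" using Q0[OF Q(3)] by simp
  have int: "integrable M (?Z s)" if "0 \<le> s" for s using Z that by (auto simp: martingale_def)
  have \<rho>Q: "\<rho> \<omega> \<in> Q" for \<omega> unfolding \<rho>_def by (rule first_hit_in[OF Q])
  have \<rho>_sets: "{\<omega> \<in> space M. \<rho> \<omega> = q} \<in> sets (F (ennreal q))" if "q \<in> Q" for q
    unfolding \<rho>_def by (rule sets_first_hit_eq[OF Q d that])
  \<comment> \<open>\<open>A\<close> with the random time frozen at \<open>q\<close>, so that it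
    becomes an event known at time \<open>q\<close>, as sampling requires.\<close>
  define A' where "A' q = {\<omega> \<in> space M. W q \<omega> < ?Z q \<omega>}" for q
  have A': "A' q \<in> sets (F (ennreal q))" if "q \<in> Q" for q
  proof -
    have [measurable]: "?Z q \<in> borel_measurable (F (ennreal q))"
      using Z Q0[OF that] by (auto simp: martingale_def)
    have "{\<omega> \<in> space M. d q \<omega>} \<inter> {\<omega> \<in> space M. ennreal q \<le> T \<omega>} \<in> sets (F (ennreal q))"
      using d[OF Q0(1)[OF that]] measurable_le_stopping_time[OF filtration_axioms T] by auto
    then have "Measurable.pred (F (ennreal q)) (\<lambda>\<omega>. d q \<omega> \<and> ennreal q \<le> T \<omega>)"
      by (simp add: pred_def space_F Int_def conj_ac cong: conj_cong)
    then have "{\<omega> \<in> space (F (ennreal q)). W q \<omega> < ?Z q \<omega>} \<in> sets (F (ennreal q))"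
      unfolding W_def by measurable
    then show ?thesis by (simp add: A'_def space_F)
  qed
  have A_eq: "A = (\<Union>q\<in>Q. {\<omega> \<in> space M. \<rho> \<omega> = q} \<inter> A' q)"
    using \<rho>Q by (auto simp: A_def A'_def)
  also have "\<dots> \<in> sets M"
    using Q(1) \<rho>_sets A' sets_F_imp_sets_M by (intro sets.finite_UN sets.Int) blast+
  finally show A: "A \<in> sets M" .
  have A_iff: "\<omega> \<in> A' (\<rho> \<omega>) \<longleftrightarrow> \<omega> \<in> A" if "\<omega> \<in> space M" for \<omega>
    using that by (auto simp: A_def A'_def)
  define V where "V \<omega> = (if \<omega> \<in> A' (\<rho> \<omega>) then ?Z t \<omega> else ?Z (\<rho> \<omega>) \<omega>)" for \<omega>
  have V: "integrable M V" "integral\<^sup>L M V = integral\<^sup>L M (?Z t)"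
    unfolding V_def by (intro discrete_optional_sampling[OF Z Q(1,2) \<rho>Q \<rho>_sets A']; assumption)+
  have "integral\<^sup>L M (?Z t) = integral\<^sup>L M (?Z 0)"
    using martingale_set_integral[OF Z order_refl t sets.top] int[OF t] int[of 0]
    by (simp add: space_F set_integral_space)
  also have "\<dots> = integral\<^sup>L M (\<lambda>_. 0)"
  proof (rule integral_cong_AE)
    show "AE \<omega> in M. ?Z 0 \<omega> = 0"
      using Y0 by eventually_elim (simp add: stopped_def)
  qed (use int[of 0] in auto)
  finally have "0 = integral\<^sup>L M V" using V by simp
  also have "\<dots> \<le> (LINT \<omega>|M. indicator A \<omega> * (\<bar>?Z t \<omega>\<bar> + c) + G \<omega>)"
  proof (rule integral_mono[OF V(1)])
    show "integrable M (\<lambda>\<omega>. indicator A \<omega> * (\<bar>?Z t \<omega>\<bar> + c) + G \<omega>)"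
      using integrable_mult_indicator[OF A, of "\<lambda>\<omega>. \<bar>?Z t \<omega>\<bar> + c"] int[OF t] G(1) by simp
    fix \<omega> assume w: "\<omega> \<in> space M"
    \<comment> \<open>On \<open>A\<close> this gives \<open>G \<ge> - c\<close>; the extra
      \<open>c\<close> in the error term absorbs this possibly negative value.\<close>
    have "- c \<le> W (\<rho> \<omega>) \<omega>" using K Q0(1)[OF \<rho>Q[of \<omega>]] by (auto simp: W_def)
    then show "V \<omega> \<le> indicator A \<omega> * (\<bar>?Z t \<omega>\<bar> + c) + G \<omega>"
      using G(2)[OF w] w A_iff[OF w] by (auto simp: V_def A_def)
  qed
  also have "\<dots> = (LINT \<omega>|M. indicator A \<omega> * (\<bar>?Z t \<omega>\<bar> + c)) + integral\<^sup>L M G"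
    using integrable_mult_indicator[OF A, of "\<lambda>\<omega>. \<bar>?Z t \<omega>\<bar> + c"] int[OF t] G(1)
    by (intro Bochner_Integration.integral_add) simp_all
  finally show "0 \<le> (LINT \<omega>|M. indicator A \<omega> * (\<bar>?Z t \<omega>\<bar> + c)) + integral\<^sup>L M G" .
qed

end

lemma tendsto_integral_indicator_vanishing:
  assumes A: "\<And>m. A m \<in> sets M" and f: "integrable M f"
    and ev: "AE \<omega> in M. \<forall>\<^sub>F m in sequentially. \<omega> \<notin> A m"
  shows "(\<lambda>m. LINT \<omega>|M. indicator (A m) \<omega> * (f \<omega> :: real)) \<longlonglongrightarrow> 0"
proof -
  have "(\<lambda>m. LINT \<omega>|M. indicator (A m) \<omega> * f \<omega>) \<longlonglongrightarrow> (LINT \<omega>|M. (0::real))"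
  proof (rule integral_dominated_convergence)
    show "integrable M (\<lambda>\<omega>. \<bar>f \<omega>\<bar>)" using f by simp
    show "(\<lambda>\<omega>. indicator (A m) \<omega> * f \<omega>) \<in> borel_measurable M" for m
      using A f by (intro borel_measurable_times borel_measurable_indicator) auto
    show "AE \<omega> in M. (\<lambda>m. indicator (A m) \<omega> * f \<omega>) \<longlonglongrightarrow> 0"
      using ev
    proof eventually_elim
      case (elim \<omega>)
      then have "\<forall>\<^sub>F m in sequentially. indicator (A m) \<omega> * f \<omega> = 0"
        by eventually_elim simp
      then show ?case by (rule tendsto_eventually)
    qed
    show "AE \<omega> in M. norm (indicator (A m) \<omega> * f \<omega>) \<le> \<bar>f \<omega>\<bar>" for m
      by (rule AE_I2) (auto simp: indicator_def)
  qed simp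
  then show ?thesis by simp
qed

section \<open>Bound on the initial value by the expected hitting time\<close>

lemma sum_power_le_inverse:
  fixes \<delta> :: real
  assumes "0 < \<delta>" "\<delta> \<le> 1"
  shows "(\<Sum>j<J. (1 - \<delta>) ^ j) \<le> 1 / \<delta>"
proof -
  have "(\<Sum>j<J. (1 - \<delta>) ^ j) = (1 - (1 - \<delta>) ^ J) / \<delta>"
    using assms by (subst sum_gp_strict) auto
  also have "\<dots> \<le> 1 / \<delta>" using assms by (intro divide_right_mono) auto
  finally show ?thesis .
qed

text \<open>If \<open>k\<close> is the first index with a hit at \<open>real k * \<tau>\<close>, or
  \<open>J\<close> if there is none, then \<open>k\<close> counts the \<open>j < k\<close> for which
  no hit occurred at the first \<open>j\<close> multiples. Taking expectations of the sum leaves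
  only avoidance probabilities, which decay geometrically.\<close>

lemma first_hit_le_sum:
  fixes \<tau> :: real
  assumes \<tau>: "0 < \<tau>"
    and Q: "finite Q" "Q \<subseteq> {0..real J * \<tau>}" "\<And>i. i \<in> {1..J} \<Longrightarrow> real i * \<tau> \<in> Q"
    and J: "1 \<le> J"
  shows "first_hit d Q (real J * \<tau>) \<omega> \<le>
    \<tau> * (\<Sum>j<J. if \<forall>i\<in>{1..j}. \<not> d (real i * \<tau>) \<omega> then 1 else 0)"
proof -
  let ?n = "\<lambda>j. if \<forall>i\<in>{1..j}. \<not> d (real i * \<tau>) \<omega> then 1 else 0 :: real"
  let ?P = "\<lambda>i. i \<in> {1..J} \<and> (i = J \<or> d (real i * \<tau>) \<omega>)"
  note Q' = Q(1,2) Q(3)[of J]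
  define k where "k = (LEAST i. ?P i)"
  have k: "?P k" unfolding k_def by (rule LeastI[of ?P J]) (use J in auto)
  have nk: "?n j = 1" if "j < k" for j
    using not_less_Least[of _ ?P] that k unfolding k_def[symmetric] by auto
  have "first_hit d Q (real J * \<tau>) \<omega> \<le> real k * \<tau>"
  proof (cases "d (real k * \<tau>) \<omega>")
    case True
    then show ?thesis using first_hit_le[OF Q', of "real k * \<tau>" d \<omega>] k Q(3) J by auto
  next
    case False
    then have "k = J" using k by auto
    then show ?thesis using first_hit_in[OF Q', of d \<omega>] J Q(2) by auto
  qed
  also have "real k = (\<Sum>j<k. ?n j)" using nk by simp
  also have "\<dots> \<le> (\<Sum>j<J. ?n j)" using k by (intro sum_mono2) auto
  finally show ?thesis using \<tau> by (simp add: mult.commute mult_left_mono)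
qed

text \<open>The constant \<open>c\<close> plays the part of \<open>u x\<close> and \<open>h\<close> that of \<open>L u\<close> along the path. On the
  exceptional event \<open>A m\<close>, where the sampled value is too large, sampling is replaced by the
  terminal value; this needs no uniform integrability, since \<open>A m\<close> vanishes as the grids \<open>Q m\<close>
  grow.\<close>

lemma (in filtered_prob_space) hitting_bound:
  fixes Y h :: "real \<Rightarrow> 'w \<Rightarrow> real"
  assumes Y: "local_martingale M F Y" and Y0: "AE \<omega> in M. Y 0 \<omega> = 0"
    and d: "\<And>s. 0 \<le> s \<Longrightarrow> {\<omega> \<in> space M. d s \<omega>} \<in> sets (F (ennreal s))"
    and d_path: "\<And>\<omega> t. \<omega> \<in> space M \<Longrightarrow> 0 \<le> t \<Longrightarrow> {s. d s \<omega>} \<inter> {0..t} \<in> sets borel"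
    and C: "countable C" "C \<subseteq> {0..}"
      "AE \<omega> in M. AE s in lborel. 0 \<le> s \<and> d s \<omega> \<longrightarrow> (\<exists>q\<in>C. q \<le> s \<and> d q \<omega>)"
    and h: "AE \<omega> in M. \<forall>t\<ge>0. set_integrable lborel {0..t} (\<lambda>s. h s \<omega>)"
    and hd: "\<And>s \<omega>. \<omega> \<in> space M \<Longrightarrow> 0 \<le> s \<Longrightarrow> -1 \<le> h s \<omega> \<or> d s \<omega>"
    and Y_le: "AE \<omega> in M. \<forall>s\<ge>0. Y s \<omega> \<le>
      (if d s \<omega> then 0 else K) - c - (LINT r:{0..s}|lborel. h r \<omega>)"
    and p: "\<And>j. prob {\<omega> \<in> space M. \<forall>i\<in>{1..j}. \<not> d (real i * \<tau>) \<omega>} \<le> (1 - \<delta>) ^ j"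
    and pos: "0 < \<tau>" "0 < \<delta>" "\<delta> \<le> 1" "0 \<le> K" "0 \<le> c"
  shows "c \<le> \<tau> / \<delta>"
proof -
  obtain T :: "nat \<Rightarrow> 'w \<Rightarrow> ennreal" where T: "\<And>k. stopping_time F (T k)"
      "AE \<omega> in M. (\<lambda>k. T k \<omega>) \<longlonglongrightarrow> \<infinity>" "\<And>k. martingale M F (stopped Y (T k))"
    using Y unfolding local_martingale_def by auto
  define N where "N j = {\<omega> \<in> space M. \<forall>i\<in>{1..j}. \<not> d (real i * \<tau>) \<omega>}" for j :: nat
  have N_sets[measurable]: "N j \<in> sets M" for j
  proof -
    have "N j = space M - (\<Union>i\<in>{1..j}. {\<omega> \<in> space M. d (real i * \<tau>) \<omega>})" by (auto simp: N_def)
    also have "\<dots> \<in> sets M"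
      using pos(1) by (intro sets.Diff sets.finite_UN sets.top) (auto intro!: sets_F_imp_sets_M[OF d])
    finally show ?thesis .
  qed
  have T_sets[measurable]: "{\<omega> \<in> space M. T k \<omega> < t} \<in> sets M" for k t
    using measurable_stopping_time[OF T(1) sets_F_subset space_F] by measurable
  \<comment> \<open>The estimate at a fixed localizing index, horizon and tolerance. Afterwards
    \<open>k\<close> tends to infinity, then \<open>J\<close>, and finally \<open>\<epsilon>\<close>
    to 0.\<close>
  have *: "c \<le> K * (prob {\<omega> \<in> space M. T k \<omega> < ennreal (real J * \<tau>)} + (1 - \<delta>) ^ J) +
      2 * \<epsilon> + \<tau> / \<delta>"
    if J: "1 \<le> J" and \<epsilon>: "0 < \<epsilon>" for k J \<epsilon>
  proof -
    define t where "t = real J * \<tau>"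
    have t: "0 \<le> t" using pos by (simp add: t_def)
    \<comment> \<open>The multiples of \<open>\<tau>\<close> carry the geometric avoidance bound and
      include \<open>t\<close> itself; the finite sets of points of \<open>C\<close> with small
      index exhaust \<open>C\<close> up to \<open>t\<close> as \<open>m\<close> grows.\<close>
    define Q where "Q m = (\<lambda>i. real i * \<tau>) ` {1..J} \<union>
        {q \<in> C. to_nat_on C q \<le> m} \<inter> {0..t}" for m
    have "finite {q \<in> C. to_nat_on C q \<le> m}" for m
    proof -
      have "{q \<in> C. to_nat_on C q \<le> m} = to_nat_on C -` {..m} \<inter> C" by auto
      then show ?thesis using finite_vimage_IntI[OF _ inj_on_to_nat_on[OF C(1)], of "{..m}"] by simp
    qed
    then have Q: "finite (Q m)" "Q m \<subseteq> {0..t}" "t \<in> Q m" for m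
      using J pos by (auto simp: Q_def t_def)
    define \<rho> where "\<rho> m = first_hit d (Q m) t" for m
    define W where "W q \<omega> = (if d q \<omega> \<and> ennreal q \<le> T k \<omega> then 0 else K) - c + q + \<epsilon>" for q \<omega>
    \<comment> \<open>A majorant independent of \<open>m\<close>: \<open>K\<close> is charged if
      \<open>T k\<close> stops early or if all multiples of \<open>\<tau>\<close> miss, and the last
      sum bounds \<open>\<rho> m\<close> by \<open>first_hit_le_sum\<close>.\<close>
    define G where "G \<omega> = K * (indicator {\<omega> \<in> space M. T k \<omega> < ennreal t} \<omega> + indicator (N J) \<omega>)
        - c + \<epsilon> + \<tau> * (\<Sum>j<J. indicator (N j) \<omega>)" for \<omega>
    define A where "A m = {\<omega> \<in> space M. W (\<rho> m \<omega>) \<omega> < stopped Y (T k) (\<rho> m \<omega>) \<omega>}" for m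
    have G_int: "integrable M G"
      unfolding G_def
      by (intro Bochner_Integration.integrable_add Bochner_Integration.integrable_diff
          Bochner_Integration.integrable_sum integrable_mult_right integrable_real_indicator
          integrable_const) (simp_all add: less_top[symmetric])
    have G_eq: "integral\<^sup>L M G = K * (prob {\<omega> \<in> space M. T k \<omega> < ennreal t} + prob (N J)) - c + \<epsilon> +
        \<tau> * (\<Sum>j<J. prob (N j))"
      unfolding G_def
      by (subst Bochner_Integration.integral_add Bochner_Integration.integral_diff
          Bochner_Integration.integral_sum integral_mult_right_zero |
          (intro Bochner_Integration.integrable_add Bochner_Integration.integrable_diff
          Bochner_Integration.integrable_sum integrable_mult_right integrable_real_indicator
          integrable_const; simp add: less_top[symmetric]; fail) | simp add: prob_space)+
    have W_G: "W (\<rho> m \<omega>) \<omega> \<le> G \<omega>" if w: "\<omega> \<in> space M" for m \<omega>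
    proof -
      have "\<rho> m \<omega> \<le> \<tau> * (\<Sum>j<J. if \<forall>i\<in>{1..j}. \<not> d (real i * \<tau>) \<omega> then 1 else 0)"
        unfolding \<rho>_def t_def using Q(1,2)[of m] J pos
        by (intro first_hit_le_sum) (auto simp: Q_def t_def)
      also have "(\<Sum>j<J. if \<forall>i\<in>{1..j}. \<not> d (real i * \<tau>) \<omega> then 1 else 0) =
          (\<Sum>j<J. indicator (N j) \<omega> :: real)"
        using w by (intro sum.cong) (auto simp: N_def indicator_def)
      finally have 1: "\<rho> m \<omega> \<le> \<tau> * (\<Sum>j<J. indicator (N j) \<omega>)" .
      have "(if d (\<rho> m \<omega>) \<omega> \<and> ennreal (\<rho> m \<omega>) \<le> T k \<omega> then 0 else K) \<le>
          K * (indicator {\<omega> \<in> space M. T k \<omega> < ennreal t} \<omega> + indicator (N J) \<omega>)"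
      proof (cases "T k \<omega> < ennreal t")
        case True
        then show ?thesis using w pos by (auto simp: indicator_def)
      next
        case False
        have "\<rho> m \<omega> \<le> t" using first_hit_in[OF Q[of m], of d \<omega>] Q(2)[of m] by (auto simp: \<rho>_def)
        then have le: "ennreal (\<rho> m \<omega>) \<le> T k \<omega>"
          using False by (meson ennreal_leI le_less_linear order_trans)
        show ?thesis
        proof (cases "d (\<rho> m \<omega>) \<omega>")
          case True
          then show ?thesis using le pos by simp
        next
          case nd: False
          then have "\<rho> m \<omega> = t" using first_hit_cases[OF Q[of m], of d \<omega>] by (simp add: \<rho>_def)
          have "\<omega> \<in> N J"
            unfolding N_def
          proof (intro CollectI conjI w ballI notI)
            fix i assume i: "i \<in> {1..J}" "d (real i * \<tau>) \<omega>"
            then have iQ: "real i * \<tau> \<in> Q m" by (auto simp: Q_def)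
            have "t \<le> real i * \<tau>"
              using first_hit_le[OF Q[of m] iQ, of d \<omega>] i(2) \<open>\<rho> m \<omega> = t\<close> by (simp add: \<rho>_def)
            moreover have "real i * \<tau> \<le> t" using Q(2)[of m] iQ by auto
            ultimately show False using i(2) nd \<open>\<rho> m \<omega> = t\<close> by simp
          qed
          then show ?thesis using pos by (simp add: indicator_def)
        qed
      qed
      with 1 show ?thesis unfolding W_def G_def by linarith
    qed
    have est: "A m \<in> sets M"
      "0 \<le> (LINT \<omega>|M. indicator (A m) \<omega> * (\<bar>stopped Y (T k) t \<omega>\<bar> + c)) + integral\<^sup>L M G" for m
      unfolding A_def W_def \<rho>_def
      by (rule grid_estimate[OF T(3) T(1) Y0 d Q pos(4,5) less_imp_le[OF \<epsilon>] G_int];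
          use W_G in \<open>simp add: W_def \<rho>_def\<close>)+
    \<comment> \<open>On almost every path, once the integral is bounded below up to error
      \<open>\<epsilon>\<close>, the stopped value is at most \<open>W\<close>, and the path has
      left \<open>A m\<close>.\<close>
    have vanish: "AE \<omega> in M. \<forall>\<^sub>F m in sequentially. \<omega> \<notin> A m"
      using C(3) h Y_le AE_space
    proof eventually_elim
      case (elim \<omega>)
      have "\<forall>\<^sub>F m in sequentially. \<forall>r\<in>{0..\<rho> m \<omega>}. - (LINT s:{0..r}|lborel. h s \<omega>) \<le> r + \<epsilon>"
      proof (rule eventually_integral_lower_bound[where D = "{s. d s \<omega>}" and t = t and C = C])
        show "set_integrable lborel {0..t} (\<lambda>s. h s \<omega>)" using elim(2) t by blast
        show "{s. d s \<omega>} \<inter> {0..t} \<in> sets borel" using d_path elim(4) t by blast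
        show "-1 \<le> h s \<omega> \<or> s \<in> {s. d s \<omega>}" if "0 \<le> s" for s using hd elim(4) that by blast
        show "AE s in lborel. 0 \<le> s \<and> s \<in> {s. d s \<omega>} \<longrightarrow> (\<exists>q\<in>C. q \<le> s \<and> q \<in> {s. d s \<omega>})"
          using elim(1) by simp
        show "\<rho> m \<omega> \<le> t" for m
          using first_hit_in[OF Q[of m], of d \<omega>] Q(2)[of m] by (auto simp: \<rho>_def)
        show "\<forall>\<^sub>F m in sequentially. \<rho> m \<omega> \<le> q" if q: "q \<in> C" "q \<le> t" "q \<in> {s. d s \<omega>}" for q
        proof (rule eventually_sequentiallyI)
          fix m assume "to_nat_on C q \<le> m"
          then have "q \<in> Q m" using q C(2) by (auto simp: Q_def)
          then show "\<rho> m \<omega> \<le> q" unfolding \<rho>_def using q by (intro first_hit_le[OF Q]) auto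
        qed
      qed (use C \<epsilon> in auto)
      then show ?case
      proof eventually_elim
        fix m assume r: "\<forall>r\<in>{0..\<rho> m \<omega>}. - (LINT s:{0..r}|lborel. h s \<omega>) \<le> r + \<epsilon>"
        have \<rho>0: "0 \<le> \<rho> m \<omega>"
          using first_hit_in[OF Q[of m], of d \<omega>] Q(2)[of m] by (auto simp: \<rho>_def)
        \<comment> \<open>The time at which the stopped process is really evaluated. If
          \<open>T k\<close> comes before \<open>\<rho> m\<close>, a hit at \<open>\<rho> m\<close>
          says nothing about time \<open>r\<close>, and \<open>W\<close> then charges
          \<open>K\<close>.\<close>
        define r where "r = enn2real (min (ennreal (\<rho> m \<omega>)) (T k \<omega>))"
        have r': "r = \<rho> m \<omega>" if "ennreal (\<rho> m \<omega>) \<le> T k \<omega>"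
          using that \<rho>0 by (simp add: r_def min_absorb1)
        have rb: "r \<in> {0..\<rho> m \<omega>}"
          using \<rho>0 enn2real_mono[of "min (ennreal (\<rho> m \<omega>)) (T k \<omega>)" "ennreal (\<rho> m \<omega>)"]
          by (auto simp: r_def)
        have "stopped Y (T k) (\<rho> m \<omega>) \<omega> = Y r \<omega>" by (simp add: stopped_def r_def)
        also have "\<dots> \<le> (if d r \<omega> then 0 else K) - c - (LINT s:{0..r}|lborel. h s \<omega>)"
          using elim(3) rb by auto
        also have "\<dots> \<le> W (\<rho> m \<omega>) \<omega>"
          using r[rule_format, OF rb] rb r' pos(4) by (auto simp: W_def)
        finally show "\<omega> \<notin> A m" by (auto simp: A_def)
      qed
    qed
    have Z_int: "integrable M (\<lambda>\<omega>. \<bar>stopped Y (T k) t \<omega>\<bar> + c)"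
      using T(3)[of k] t by (auto simp: martingale_def)
    have "(\<lambda>m. LINT \<omega>|M. indicator (A m) \<omega> * (\<bar>stopped Y (T k) t \<omega>\<bar> + c)) \<longlonglongrightarrow> 0"
      by (rule tendsto_integral_indicator_vanishing[OF est(1) Z_int vanish])
    then have "(\<lambda>m. (LINT \<omega>|M. indicator (A m) \<omega> * (\<bar>stopped Y (T k) t \<omega>\<bar> + c)) + integral\<^sup>L M G)
        \<longlonglongrightarrow> 0 + integral\<^sup>L M G"
      by (intro tendsto_intros)
    then have "0 \<le> integral\<^sup>L M G"
      using est(2) by (auto intro: LIMSEQ_le_const)
    then have "c \<le> K * (prob {\<omega> \<in> space M. T k \<omega> < ennreal t} + prob (N J)) + \<epsilon> +
        \<tau> * (\<Sum>j<J. prob (N j))" by (simp add: G_eq)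
    also have "\<dots> \<le> K * (prob {\<omega> \<in> space M. T k \<omega> < ennreal t} + (1 - \<delta>) ^ J) + \<epsilon> +
        \<tau> * (\<Sum>j<J. (1 - \<delta>) ^ j)"
      using pos p unfolding N_def by (intro add_mono mult_left_mono sum_mono order_refl) auto
    also have "\<tau> * (\<Sum>j<J. (1 - \<delta>) ^ j) \<le> \<tau> * (1 / \<delta>)"
      using pos sum_power_le_inverse[of \<delta> J] by (intro mult_left_mono) auto
    finally show ?thesis using \<epsilon> by (simp add: t_def)
  qed
  have T_lim: "(\<lambda>k. prob {\<omega> \<in> space M. T k \<omega> < ennreal t}) \<longlonglongrightarrow> 0" for t :: real
  proof -
    have "(\<lambda>k. LINT \<omega>|M. indicator {\<omega> \<in> space M. T k \<omega> < ennreal t} \<omega> * (1::real)) \<longlonglongrightarrow> 0"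
    proof (rule tendsto_integral_indicator_vanishing[OF T_sets])
      show "AE \<omega> in M. \<forall>\<^sub>F k in sequentially. \<omega> \<notin> {\<omega> \<in> space M. T k \<omega> < ennreal t}"
        using T(2)
      proof eventually_elim
        case (elim \<omega>)
        then have "\<forall>\<^sub>F k in sequentially. ennreal t < T k \<omega>"
          by (rule order_tendstoD) simp
        then show ?case by eventually_elim auto
      qed
    qed simp
    then show ?thesis by simp
  qed
  have "c \<le> K * (1 - \<delta>) ^ J + 2 * \<epsilon> + \<tau> / \<delta>" if "1 \<le> J" "0 < \<epsilon>" for J \<epsilon>
  proof (rule LIMSEQ_le_const)
    show "(\<lambda>k. K * (prob {\<omega> \<in> space M. T k \<omega> < ennreal (real J * \<tau>)} + (1 - \<delta>) ^ J) +
        2 * \<epsilon> + \<tau> / \<delta>) \<longlonglongrightarrow> K * (1 - \<delta>) ^ J + 2 * \<epsilon> + \<tau> / \<delta>"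
      by (rule tendsto_eq_intros T_lim refl | simp)+
  qed (use * that in auto)
  then have "c \<le> 2 * \<epsilon> + \<tau> / \<delta>" if "0 < \<epsilon>" for \<epsilon>
  proof (intro LIMSEQ_le_const)
    show "(\<lambda>J. K * (1 - \<delta>) ^ J + 2 * \<epsilon> + \<tau> / \<delta>) \<longlonglongrightarrow> 2 * \<epsilon> + \<tau> / \<delta>"
      using pos by (auto intro!: tendsto_eq_intros LIMSEQ_power_zero)
  qed (use that in auto)
  then have "c \<le> \<tau> / \<delta> + e" if "0 < e" for e
    using that half_gt_zero[OF that] by (metis add.commute field_sum_of_halves mult_2)
  then show ?thesis by (rule field_le_epsilon)
qed

section \<open>Markov processes\<close>

lemma space_cemetery_borel [simp]: "space cemetery_borel = UNIV"
  by (simp add: cemetery_borel_def space_measure_of_conv)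

lemma sets_cemetery_borelI: "Some -` B \<in> sets borel \<Longrightarrow> B \<in> sets cemetery_borel"
  by (simp add: cemetery_borel_def)

lemma Some_image_sets_cemetery_borel: "A \<in> sets borel \<Longrightarrow> Some ` A \<in> sets cemetery_borel"
  by (rule sets_cemetery_borelI) (simp add: inj_vimage_image_eq)

lemma space_natural_filtration [simp]: "space (natural_filtration \<Omega> X t) = space \<Omega>"
  by (simp add: natural_filtration_def space_measure_of_conv)

lemma vimage_sets_natural_filtration:
  assumes "0 \<le> s" "ennreal s \<le> t" "B \<in> sets cemetery_borel"
  shows "X s -` B \<inter> space \<Omega> \<in> sets (natural_filtration \<Omega> X t)"
  unfolding natural_filtration_def using assms
  by (subst sets_measure_of) (auto intro!: sigma_sets.Basic)

lemma sets_natural_filtration_mono: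
  assumes "s \<le> t"
  shows "sets (natural_filtration \<Omega> X s) \<subseteq> sets (natural_filtration \<Omega> X t)"
  unfolding natural_filtration_def using order_trans[OF _ assms]
  by (subst (1 2) sets_measure_of) (auto intro!: sigma_sets_mono')

context markov_process
begin

lemma space_law: "space (\<P> x) = space \<Omega>"
  by (rule sets_eq_imp_space_eq[OF sets_law])

lemma sets_natural_filtration_subset: "sets (natural_filtration \<Omega> X t) \<subseteq> sets \<Omega>"
proof -
  have "{X s -` B \<inter> space \<Omega> |s B. 0 \<le> s \<and> ennreal s \<le> t \<and> B \<in> sets cemetery_borel} \<subseteq> sets \<Omega>"
    using measurable_sets[OF random_variable] by auto
  then show ?thesis
    unfolding natural_filtration_def
    by (subst sets_measure_of) (auto intro!: sets.sigma_sets_subset)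
qed

lemma filtered_prob_space_law: "filtered_prob_space (\<P> x) (natural_filtration \<Omega> X)"
proof -
  interpret prob_space "\<P> x" by (rule prob)
  show ?thesis
  proof unfold_locales
    show "space (natural_filtration \<Omega> X t) = space (\<P> x)" for t
      by (simp add: space_law)
    show "sets (natural_filtration \<Omega> X t) \<subseteq> sets (\<P> x)" for t
      using sets_natural_filtration_subset by (simp add: sets_law)
  qed (rule sets_natural_filtration_mono)
qed

lemma hit_sets:
  assumes "D \<in> sets borel" "0 \<le> s"
  shows "{\<omega> \<in> space (\<P> x). X s \<omega> \<in> Some ` D} \<in> sets (natural_filtration \<Omega> X (ennreal s))"
proof -
  have "{\<omega> \<in> space (\<P> x). X s \<omega> \<in> Some ` D} = X s -` (Some ` D) \<inter> space \<Omega>"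
    by (auto simp: space_law)
  then show ?thesis
    using vimage_sets_natural_filtration[OF assms(2) order_refl
        Some_image_sets_cemetery_borel[OF assms(1)], of X \<Omega>] by simp
qed

text \<open>Progressive measurability is joint measurability for the natural filtration at time
  \<open>t\<close>, whose sets are measurable under the law. This is the input for finding the
  countable hitting times.\<close>

lemma hit_sets_pair:
  assumes pm: "progressively_measurable \<Omega> X" and D: "D \<in> sets borel" and t: "0 \<le> t"
  shows "{(s, \<omega>). s \<in> {0..t} \<and> \<omega> \<in> space (\<P> x) \<and> X s \<omega> \<in> Some ` D} \<in>
    sets (restrict_space borel {0..t} \<Otimes>\<^sub>M \<P> x)" (is "?S \<in> sets (?R \<Otimes>\<^sub>M _)")
proof -
  let ?F = "natural_filtration \<Omega> X (ennreal t)"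
  have "(\<lambda>\<omega>. \<omega>) \<in> \<P> x \<rightarrow>\<^sub>M ?F"
    using sets_natural_filtration_subset[of "ennreal t"]
    by (intro measurableI) (auto simp: space_law sets_law dest: sets.sets_into_space
        intro: sets.Int)
  then have "(\<lambda>p. (fst p, snd p)) \<in> ?R \<Otimes>\<^sub>M \<P> x \<rightarrow>\<^sub>M ?R \<Otimes>\<^sub>M ?F"
    by (intro measurable_Pair measurable_fst measurable_compose[OF measurable_snd])
  then have "(\<lambda>p. X (fst p) (snd p)) \<in> ?R \<Otimes>\<^sub>M \<P> x \<rightarrow>\<^sub>M cemetery_borel"
    using pm t measurable_compose[of "\<lambda>p. (fst p, snd p)" _ "?R \<Otimes>\<^sub>M ?F" "\<lambda>(s, \<omega>). X s \<omega>"]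
    by (auto simp: progressively_measurable_def)
  from measurable_sets[OF this Some_image_sets_cemetery_borel[OF D]]
  show ?thesis
    by (rule back_subst[of "\<lambda>S. S \<in> _"]) (auto simp: space_pair_measure space_restrict_space)
qed

lemma hit_sets_path:
  assumes pm: "progressively_measurable \<Omega> X" and D: "D \<in> sets borel" and t: "0 \<le> t"
    and \<omega>: "\<omega> \<in> space (\<P> x)"
  shows "{s. X s \<omega> \<in> Some ` D} \<inter> {0..t} \<in> sets borel"
proof -
  have "(\<lambda>s. (s, \<omega>)) -` {(s, \<omega>). s \<in> {0..t} \<and> \<omega> \<in> space (\<P> x) \<and> X s \<omega> \<in> Some ` D} \<in>
      sets (restrict_space borel {0..t})"
    by (rule sets_Pair2[OF hit_sets_pair[OF pm D t]])
  also have "(\<lambda>s. (s, \<omega>)) -` {(s, \<omega>). s \<in> {0..t} \<and> \<omega> \<in> space (\<P> x) \<and> X s \<omega> \<in> Some ` D} =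
      {s. X s \<omega> \<in> Some ` D} \<inter> {0..t}"
    using \<omega> by auto
  finally show ?thesis by (simp add: sets_restrict_space_iff)
qed

text \<open>Induction by the Markov property at time \<open>real j * \<tau>\<close>: given the past,
  the next grid point falls into \<open>H\<close> with conditional probability at least
  \<open>\<delta>\<close>, so each step retains at most the fraction
  \<open>1 - \<delta>\<close>.\<close>

lemma prob_avoid_le:
  assumes ne: "nonexplosive \<P> X" and H: "H \<in> sets borel" and \<tau>: "0 \<le> \<tau>"
    and \<delta>: "\<And>y. \<delta> \<le> measure (P \<tau> y) H" "\<delta> \<le> 1"
  shows "measure (\<P> x) {\<omega> \<in> space (\<P> x). \<forall>i\<in>{1..j}. X (real i * \<tau>) \<omega> \<notin> Some ` H} \<le> (1 - \<delta>) ^ j"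
proof (induction j)
  case 0
  interpret prob_space "\<P> x" by (rule prob)
  show ?case by (simp add: prob_space)
next
  case (Suc j)
  interpret filtered_prob_space "\<P> x" "natural_filtration \<Omega> X" by (rule filtered_prob_space_law)
  define s where "s = real j * \<tau>"
  have s: "0 \<le> s" using \<tau> by (simp add: s_def)
  interpret sigma_finite_subalgebra "\<P> x" "natural_filtration \<Omega> X (ennreal s)"
    by (rule sigma_finite_subalgebra_F)
  define N where "N j = {\<omega> \<in> space (\<P> x). \<forall>i\<in>{1..j}. X (real i * \<tau>) \<omega> \<notin> Some ` H}" for j :: nat
  define B where "B = {\<omega> \<in> space (\<P> x). X (s + \<tau>) \<omega> \<in> Some ` H}"
  have B: "B \<in> sets (\<P> x)"
    unfolding B_def using hit_sets[OF H, of "s + \<tau>" x] s \<tau> by (auto intro: sets_F_imp_sets_M)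
  have N: "N j \<in> sets (natural_filtration \<Omega> X (ennreal s))"
  proof -
    have "N j = space (\<P> x) - (\<Union>i\<in>{1..j}. {\<omega> \<in> space (\<P> x). X (real i * \<tau>) \<omega> \<in> Some ` H})"
      by (auto simp: N_def)
    also have "\<dots> \<in> sets (natural_filtration \<Omega> X (ennreal s))"
    proof (intro sets.Diff sets.finite_UN)
      show "space (\<P> x) \<in> sets (natural_filtration \<Omega> X (ennreal s))"
        using sets.top[of "natural_filtration \<Omega> X (ennreal s)"] by (simp add: space_law)
      fix i assume "i \<in> {1..j}"
      then have "real i * \<tau> \<le> s" using \<tau> by (auto simp: s_def intro: mult_right_mono)
      then show "{\<omega> \<in> space (\<P> x). X (real i * \<tau>) \<omega> \<in> Some ` H} \<in>
          sets (natural_filtration \<Omega> X (ennreal s))"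
        using hit_sets[OF H, of "real i * \<tau>" x] \<tau> sets_F_mono[OF ennreal_leI] by fastforce
    qed simp
    finally show ?thesis .
  qed
  have N': "N j \<in> sets (\<P> x)" by (rule sets_F_imp_sets_M[OF N])
  define f where "f \<omega> = (indicator (Some ` H) (X (s + \<tau>) \<omega>) :: real)" for \<omega>
  have f_eq: "f \<omega> = indicator B \<omega>" if "\<omega> \<in> space (\<P> x)" for \<omega>
    using that by (auto simp: f_def B_def indicator_def)
  have f: "integrable (\<P> x) f"
    using B by (subst Bochner_Integration.integrable_cong[OF refl f_eq]) (auto simp: less_top[symmetric])
  let ?c = "real_cond_exp (\<P> x) (natural_filtration \<Omega> X (ennreal s)) f"
  have c: "integrable (\<P> x) ?c" by (rule real_cond_exp_int(1)[OF f])
  have "prob (N j \<inter> B) = (LINT \<omega>|\<P> x. indicator (N j \<inter> B) \<omega>)"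
    using N' B by simp
  also have "\<dots> = (LINT \<omega>:N j|\<P> x. f \<omega>)"
    unfolding set_lebesgue_integral_def
    by (intro Bochner_Integration.integral_cong refl) (auto simp: f_eq indicator_def)
  also have "\<dots> = (LINT \<omega>:N j|\<P> x. ?c \<omega>)"
    by (rule real_cond_exp_intA[OF f N])
  also have "\<dots> \<ge> (LINT \<omega>|\<P> x. \<delta> * indicator (N j) \<omega>)"
    unfolding set_lebesgue_integral_def
  proof (rule integral_mono_AE)
    show "integrable (\<P> x) (\<lambda>\<omega>. indicator (N j) \<omega> *\<^sub>R ?c \<omega>)"
      by (rule integrable_mult_indicator[OF N' c])
    show "integrable (\<P> x) (\<lambda>\<omega>. \<delta> * indicator (N j) \<omega>)"
      using N' by (auto simp: less_top[symmetric])
    have "AE \<omega> in \<P> x. ?c \<omega> = ext (\<lambda>y. measure (P \<tau> y) H) (X s \<omega>)"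
      unfolding f_def by (rule markov_property[OF s \<tau> H])
    moreover have "AE \<omega> in \<P> x. \<forall>t\<ge>0. X t \<omega> \<noteq> None"
      using ne by (simp add: nonexplosive_def)
    ultimately show "AE \<omega> in \<P> x. \<delta> * indicator (N j) \<omega> \<le> indicator (N j) \<omega> *\<^sub>R ?c \<omega>"
    proof eventually_elim
      case (elim \<omega>)
      \<comment> \<open>Nonexplosion enters here: at the cemetery \<open>ext\<close> is 0 and the
        lower bound \<open>\<delta>\<close> would fail.\<close>
      then obtain y where "X s \<omega> = Some y" using s by blast
      then show ?case using elim(1) \<delta>(1)[of y] by (auto simp: ext_def indicator_def)
    qed
  qed
  finally have NB: "\<delta> * prob (N j) \<le> prob (N j \<inter> B)"
    using N' by simp
  have "N (Suc j) = N j - N j \<inter> B"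
    by (auto simp: N_def B_def s_def atLeastAtMostSuc_conv algebra_simps)
  then have "prob (N (Suc j)) = prob (N j) - prob (N j \<inter> B)"
    using N' B by (simp add: finite_measure_Diff)
  also have "\<dots> \<le> (1 - \<delta>) * prob (N j)" using NB by (simp add: algebra_simps)
  also have "\<dots> \<le> (1 - \<delta>) ^ Suc j"
    using Suc.IH \<delta>(2) by (simp add: N_def mult_left_mono)
  finally show ?case by (simp add: N_def)
qed

text \<open>Instantiates \<open>hitting_bound\<close> with the process \<open>Y\<close> attached to
  the pair \<open>(u, g)\<close> and with \<open>c = u x\<close>. Paths are stopped on hitting
  \<open>D\<close>, where \<open>g\<close> is uncontrolled but \<open>u\<close> vanishes, while the
  avoidance probabilities come from the smaller set \<open>H\<close>.\<close>

lemma subsolution_bound: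
  assumes pm: "progressively_measurable \<Omega> X" and ne: "nonexplosive \<P> X"
    and gp: "generator_pair \<Omega> \<P> X u g"
    and D: "D \<in> sets borel" and H: "H \<in> sets borel" "H \<subseteq> D"
    and g: "\<And>y. y \<notin> D \<Longrightarrow> -1 \<le> g y"
    and u: "\<And>y. 0 \<le> u y" "\<And>y. y \<in> D \<Longrightarrow> u y = 0" "\<And>y. u y \<le> K"
    and \<tau>: "0 < \<tau>" and \<delta>: "0 < \<delta>" "\<And>y. \<delta> \<le> measure (P \<tau> y) H" "\<delta> \<le> 1"
  shows "u x \<le> \<tau> / \<delta>"
proof -
  interpret filtered_prob_space "\<P> x" "natural_filtration \<Omega> X" by (rule filtered_prob_space_law)
  define d where "d s \<omega> \<longleftrightarrow> X s \<omega> \<in> Some ` D" for s \<omega>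
  define Y where "Y t \<omega> = ext u (X t \<omega>) - ext u (X 0 \<omega>) -
      (LINT s:{0..t}|lborel. ext g (X s \<omega>))" for t \<omega>
  obtain C where C: "countable C" "C \<subseteq> {0..}"
    "AE \<omega> in \<P> x. AE s in lborel. 0 \<le> s \<and> d s \<omega> \<longrightarrow> (\<exists>q\<in>C. q \<le> s \<and> d q \<omega>)"
    by (rule countable_hitting_times[OF finite_measure_axioms, of d])
      (use hit_sets_pair[OF pm D] in \<open>simp_all add: d_def\<close>)
  have K: "0 \<le> K" using u(1,3) order_trans by blast
  show ?thesis
  proof (rule hitting_bound[of Y d C "\<lambda>s \<omega>. ext g (X s \<omega>)" K "u x" \<tau> \<delta>])
    show "local_martingale (\<P> x) (natural_filtration \<Omega> X) Y"
      using gp unfolding Y_def[abs_def] generator_pair_def by blast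
    show "AE \<omega> in \<P> x. \<forall>t\<ge>0. set_integrable lborel {0..t} (\<lambda>s. ext g (X s \<omega>))"
      using gp unfolding generator_pair_def by blast
    \<comment> \<open>At time 0 the integral runs over a single point, a Lebesgue-null set.\<close>
    have "(LINT s:{0..0}|lborel. f s) = 0" for f :: "real \<Rightarrow> real"
      unfolding set_lebesgue_integral_def using AE_lborel_singleton[of "0::real"]
      by (intro integral_eq_zero_AE) (auto elim: eventually_mono)
    then show "AE \<omega> in \<P> x. Y 0 \<omega> = 0" by (simp add: Y_def)
    show "{\<omega> \<in> space (\<P> x). d s \<omega>} \<in> sets (natural_filtration \<Omega> X (ennreal s))" if "0 \<le> s" for s
      unfolding d_def by (rule hit_sets[OF D that])
    show "{s. d s \<omega>} \<inter> {0..t} \<in> sets borel" if "\<omega> \<in> space (\<P> x)" "0 \<le> t" for \<omega> t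
      unfolding d_def by (rule hit_sets_path[OF pm D that(2,1)])
    show "-1 \<le> ext g (X s \<omega>) \<or> d s \<omega>" for s \<omega>
      using g by (cases "X s \<omega>") (auto simp: ext_def d_def)
    show "AE \<omega> in \<P> x. \<forall>s\<ge>0. Y s \<omega> \<le> (if d s \<omega> then 0 else K) - u x -
        (LINT r:{0..s}|lborel. ext g (X r \<omega>))"
      using start[of x]
    proof eventually_elim
      case (elim \<omega>)
      have "ext u (X s \<omega>) \<le> (if d s \<omega> then 0 else K)" for s
        using u K by (cases "X s \<omega>") (auto simp: ext_def d_def)
      then show ?case using elim by (auto simp: Y_def ext_def)
    qed
    show "prob {\<omega> \<in> space (\<P> x). \<forall>i\<in>{1..j}. \<not> d (real i * \<tau>) \<omega>} \<le> (1 - \<delta>) ^ j" for j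
    proof -
      have "{\<omega> \<in> space (\<P> x). \<forall>i\<in>{1..j}. X (real i * \<tau>) \<omega> \<notin> Some ` H} =
          space (\<P> x) - (\<Union>i\<in>{1..j}. {\<omega> \<in> space (\<P> x). X (real i * \<tau>) \<omega> \<in> Some ` H})" by auto
      also have "\<dots> \<in> sets (\<P> x)"
        using \<tau> by (intro sets.Diff sets.finite_UN sets.top)
          (auto intro!: sets_F_imp_sets_M[OF hit_sets[OF H(1)]])
      finally have "prob {\<omega> \<in> space (\<P> x). \<forall>i\<in>{1..j}. \<not> d (real i * \<tau>) \<omega>} \<le>
          prob {\<omega> \<in> space (\<P> x). \<forall>i\<in>{1..j}. X (real i * \<tau>) \<omega> \<notin> Some ` H}"
        \<comment> \<open>Since \<open>H \<subseteq> D\<close>, a path avoiding \<open>D\<close>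
          also avoids \<open>H\<close>.\<close>
        by (intro finite_measure_mono) (use H(2) in \<open>auto simp: d_def\<close>)
      then show ?thesis
        using prob_avoid_le[OF ne H(1) _ \<delta>(2,3), of x j] \<tau> by simp
    qed
  qed (use C \<tau> \<delta> K u in auto)
qed

end

section \<open>Uniform minorization from strong ergodicity\<close>

context transition_function
begin

text \<open>A real supremum is an upper bound only for a set bounded above. The bound 1, available
  because \<open>P t x\<close> is a subprobability and \<open>\<nu>\<close> a probability, settles
  this for the supremum over sets and later for the one over starting points.\<close>

lemma
  assumes \<nu>: "prob_space \<nu>" and t: "0 \<le> t"
  shows measure_diff_le_tv_dist:
      "A \<in> sets borel \<Longrightarrow> \<bar>measure (P t x) A - measure \<nu> A\<bar> \<le> tv_dist (P t x) \<nu>"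
    and tv_dist_le_1: "tv_dist (P t x) \<nu> \<le> 1"
proof -
  interpret prob_space \<nu> by (rule \<nu>)
  have "P t x \<in> space (subprob_algebra borel)"
    using measurable_space[OF kernel[OF t]] by simp
  then interpret p: subprob_space "P t x" by (simp add: space_subprob_algebra)
  have le: "\<bar>measure (P t x) A - measure \<nu> A\<bar> \<le> 1" for A
    using p.subprob_measure_le_1[of A] prob_le_1[of A]
      measure_nonneg[of "P t x" A] measure_nonneg[of \<nu> A] by linarith
  show "\<bar>measure (P t x) A - measure \<nu> A\<bar> \<le> tv_dist (P t x) \<nu>" if "A \<in> sets borel"
    unfolding tv_dist_def using that le by (intro cSUP_upper bdd_aboveI[of _ 1]) auto
  show "tv_dist (P t x) \<nu> \<le> 1"
    unfolding tv_dist_def using le by (intro cSUP_least) auto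
qed

text \<open>Uniqueness identifies the limit in strong ergodicity with \<open>\<pi>\<close>. Once
  \<open>C * exp (- \<epsilon> * \<tau>)\<close> is below half of \<open>measure \<pi> A\<close>,
  total variation leaves at least the other half to \<open>P \<tau> y\<close>, uniformly in
  \<open>y\<close>.\<close>

lemma strongly_ergodic_minorization:
  assumes se: "strongly_ergodic P" and uniq: "\<And>\<nu>. invariant_prob P \<nu> \<Longrightarrow> \<nu> = \<pi>"
    and A: "A \<in> sets borel" "0 < measure \<pi> A"
  obtains \<tau> where "0 < \<tau>" "\<And>y. measure \<pi> A / 2 \<le> measure (P \<tau> y) A"
proof -
  obtain \<epsilon> C \<nu> where \<epsilon>: "0 < \<epsilon>" and C: "0 < C" and \<nu>: "invariant_prob P \<nu>"
    and le: "\<And>t. 0 \<le> t \<Longrightarrow> (\<Squnion>x. tv_dist (P t x) \<nu>) \<le> C * exp (- \<epsilon> * t)"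
    using se unfolding strongly_ergodic_def by blast
  have \<nu>: "prob_space \<pi>" "\<nu> = \<pi>" using \<nu> uniq[OF \<nu>] by (auto simp: invariant_prob_def)
  have "((\<lambda>t. C * exp (- \<epsilon> * t)) \<longlongrightarrow> 0) at_top"
    using \<epsilon> C by real_asymp
  then have "\<forall>\<^sub>F t in at_top. C * exp (- \<epsilon> * t) < measure \<pi> A / 2"
    using A(2) by (intro order_tendstoD(2)) auto
  then have "\<forall>\<^sub>F t in at_top. 0 < t \<and> C * exp (- \<epsilon> * t) < measure \<pi> A / 2"
    using eventually_gt_at_top[of 0] by eventually_elim auto
  then obtain \<tau> where \<tau>: "0 < \<tau>" "C * exp (- \<epsilon> * \<tau>) < measure \<pi> A / 2"
    by (auto simp: eventually_at_top_linorder)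
  have "measure \<pi> A / 2 \<le> measure (P \<tau> y) A" for y
  proof -
    have "tv_dist (P \<tau> y) \<pi> \<le> (\<Squnion>x. tv_dist (P \<tau> x) \<pi>)"
      using tv_dist_le_1[OF \<nu>(1) less_imp_le[OF \<tau>(1)]]
      by (intro cSUP_upper bdd_aboveI[of _ 1]) auto
    then show ?thesis
      using measure_diff_le_tv_dist[OF \<nu>(1) less_imp_le[OF \<tau>(1)] A(1), of y]
        le[OF less_imp_le[OF \<tau>(1)]] \<tau>(2) \<nu>(2) by (simp add: abs_le_iff)
  qed
  with \<tau>(1) show thesis by (rule that)
qed

end

theorem theorem2:
  fixes P :: "real \<Rightarrow> 'a::polish_space \<Rightarrow> 'a measure"
    and \<Omega> :: "'w measure" and \<P> :: "'a \<Rightarrow> 'w measure" and X :: "real \<Rightarrow> 'w \<Rightarrow> 'a option"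
    and L :: "('a \<Rightarrow> real) \<Rightarrow> 'a \<Rightarrow> real" and \<pi> :: "'a measure"
    and E :: "nat \<Rightarrow> 'a set" and H :: "'a set"
  assumes "markov_process P \<Omega> \<P> X"
    and "right_continuous \<P> X"
    and "progressively_measurable \<Omega> X"
    and "extended_generator \<Omega> \<P> X L"
    and "nonexplosive \<P> X"
    and "ergodic P \<pi>"
    and "\<And>n. n \<ge> 1 \<Longrightarrow> open (E n) \<and> bounded (E n)"
    and "\<And>n. n \<ge> 1 \<Longrightarrow> E n \<subseteq> E (Suc n)"
    and "(\<Union>n\<in>{1..}. E n) = UNIV"
    and "closed H" and "H \<subseteq> E 1" and "measure \<pi> H > 0"
    and "\<exists>u :: nat \<Rightarrow> 'a \<Rightarrow> real.
      (\<forall>n\<ge>1. u n \<in> generator_domain \<Omega> \<P> X \<and> (\<forall>x. u n x \<ge> 0) \<and>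
         (\<forall>x\<in>E n - H. L (u n) x \<ge> -1) \<and>
         (\<forall>x\<in>- E n \<union> H. u n x = 0) \<and> bounded (u n ` (E n - H))) \<and>
      (\<Squnion>x\<in>- H. limsup (\<lambda>n. ereal (u n x))) = \<infinity>"
  shows "\<not> strongly_ergodic P"
proof
  assume se: "strongly_ergodic P"
  interpret markov_process P \<Omega> \<P> X by fact
  have uniq: "\<And>\<nu>. invariant_prob P \<nu> \<Longrightarrow> \<nu> = \<pi>" and \<pi>: "prob_space \<pi>"
    using assms(6) by (auto simp: ergodic_def invariant_prob_def)
  have H: "H \<in> sets borel" using \<open>closed H\<close> by simp
  define \<delta> where "\<delta> = measure \<pi> H / 2"
  have \<delta>: "0 < \<delta>" "\<delta> \<le> 1"
    using assms(12) prob_space.prob_le_1[OF \<pi>, of H] by (auto simp: \<delta>_def)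
  obtain \<tau> where \<tau>: "0 < \<tau>" "\<And>y. \<delta> \<le> measure (P \<tau> y) H"
    using strongly_ergodic_minorization[OF se uniq H assms(12)] unfolding \<delta>_def by blast
  obtain u where u: "\<And>n. n \<ge> 1 \<Longrightarrow> u n \<in> generator_domain \<Omega> \<P> X"
      "\<And>n x. n \<ge> 1 \<Longrightarrow> u n x \<ge> 0" "\<And>n x. n \<ge> 1 \<Longrightarrow> x \<in> E n - H \<Longrightarrow> L (u n) x \<ge> -1"
      "\<And>n x. n \<ge> 1 \<Longrightarrow> x \<in> - E n \<union> H \<Longrightarrow> u n x = 0"
      "\<And>n. n \<ge> 1 \<Longrightarrow> bounded (u n ` (E n - H))"
      and sup: "(\<Squnion>x\<in>- H. limsup (\<lambda>n. ereal (u n x))) = \<infinity>"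
    using assms(13) by blast
  have le: "u n x \<le> \<tau> / \<delta>" if n: "n \<ge> 1" for n x
  proof -
    obtain K where K: "\<And>y. y \<in> E n - H \<Longrightarrow> \<bar>u n y\<bar> \<le> K"
      using u(5)[OF n] unfolding bounded_iff by auto
    \<comment> \<open>\<open>u n\<close> vanishes off \<open>E n - H\<close>, and \<open>K\<close>
      may be negative when that set is empty.\<close>
    have "u n y \<le> max 0 K" for y
      using K[of y] u(4)[OF n, of y] by (cases "y \<in> E n - H") auto
    moreover have "generator_pair \<Omega> \<P> X (u n) (L (u n))"
      using assms(4) u(1)[OF n] by (simp add: extended_generator_def)
    \<comment> \<open>This is the set \<open>D\<close> of \<open>subsolution_bound\<close>; its
      complement is \<open>E n - H\<close>, where \<open>L (u n) \<ge> -1\<close>. The resulting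
      bound \<open>\<tau> / \<delta>\<close> depends neither on \<open>n\<close> nor on the sup norm
      \<open>K\<close>.\<close>
    moreover have "- E n \<union> H \<in> sets borel" using assms(7)[OF n] H by auto
    ultimately show ?thesis
      using u(2-4)[OF n] H \<tau> \<delta> assms(3,5)
      by (intro subsolution_bound[of "u n" "L (u n)" "- E n \<union> H" H]) auto
  qed
  have "limsup (\<lambda>n. ereal (u n x)) \<le> ereal (\<tau> / \<delta>)" for x
    using le by (intro Limsup_bounded eventually_sequentiallyI[of 1]) auto
  then have "(\<Squnion>x\<in>- H. limsup (\<lambda>n. ereal (u n x))) \<le> ereal (\<tau> / \<delta>)"
    by (intro SUP_least)
  then show False by (simp add: sup)
qed

end
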